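(* For every $n\ge1$, $$\mathscr R_{n,\mathbb R}\cap\Lambda_{\mathbb Z}^n=\bigoplus_{d\mid n}\mathbb Z\,Q_{n,d}=\bigoplus_{e\mid n}\mathbb Z\,\ell_n^{(e)}.$$ Equivalently, for $F=\sum_{d\mid n}x_dQ_{n,d}\in\mathscr R_{n,\mathbb R}$ (with $x_d\in\mathbb R$), the following are equivalent: (i) every Schur coefficient of $F$ is an integer; (ii) $x_d\in\mathbb Z$ for every $d\mid n$; (iii) every coefficient of $F$ in the Foulkes basis $\{\ell_n^{(e)}:e\mid n\}$ is an integer.
   Context: $p_d$, $s_\lambda$ are power-sum and Schur symmetric functions. $\mathscr R_{n,\mathbb R}$ is the real span of $\{p_d^{\,n/d}:d\mid n\}$, and $\Lambda^n_{\mathbb Z}=\bigoplus_{\lambda\vdash n}\mathbb Zs_\lambda$. For $r\in\mathbb Z$, $\ell_n^{(r)}$ is the Frobenius characteristic of $\operatorname{Ind}_{C_n}^{S_n}V_r$, where $C_n=\langle(1\,2\cdots n)\rangle$ and $V_r$ is the one-dimensional complex $C_n$-module on which $(1\,2\cdots n)$ acts by $\exp(2\pi i r/n)$. For $d\mid n$, $Q_{n,d}:=\ell_{n/d}^{(1)}[p_d]$ (plethysm: each $p_k$ is replaced by $p_{dk}$); explicitly $Q_{n,d}=\frac dn\sum_{u\mid n/d}\mu(u)p_{du}^{\,n/(du)}$. Both $\{Q_{n,d}\}_{d\mid n}$ and $\{\ell_n^{(e)}\}_{e\mid n}$ are bases of $\mathscr R_{n,\mathbb R}$, related by $\ell_n^{(r)}=\sum_{d\mid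 r}Q_{n,d}$ for $r\mid n$. *)

theory Defs
  imports
    Complex_Main
    "HOL-Library.Multiset"
    "HOL-Library.FuncSet"
    "HOL-Library.Function_Algebras"
    "HOL-Combinatorics.Combinatorics"
begin

section \<open>Formal power series in the variables $x_0, x_1, x_2, \ldots$\<close>

text \<open>
  Symmetric functions are formal power series in countably many variables.  A multiset \<open>m\<close>
  of naturals stands for the monomial $\prod_{i \in m} x_i$ (with multiplicities), so that the
  multiset sum is the product of monomials, and \<open>mcoeff f m\<close> is the coefficient of
  that monomial in \<open>f\<close>.
\<close>

typedef 'a mfps = "UNIV :: (nat multiset \<Rightarrow> 'a) set"
  morphisms mcoeff Mfps
  by simp

lemma mcoeff_Mfps [simp]: "mcoeff (Mfps f) = f"
  by (simp add: Mfps_inverse)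

lemma mfps_eqI: "(\<And>m. mcoeff f m = mcoeff g m) \<Longrightarrow> f = g"
  by (metis ext mcoeff_inject)

lemma finite_submultisets: "finite {a. a \<subseteq># (m :: 'b multiset)}"
proof (induction m)
  case empty
  then show ?case by simp
next
  case (add x m)
  have "{a. a \<subseteq># add_mset x m} \<subseteq> {a. a \<subseteq># m} \<union> add_mset x ` {a. a \<subseteq># m}"
  proof
    fix a assume "a \<in> {a. a \<subseteq># add_mset x m}"
    then have a: "a \<subseteq># add_mset x m" by simp
    show "a \<in> {a. a \<subseteq># m} \<union> add_mset x ` {a. a \<subseteq># m}"
    proof (cases "x \<in># a")
      case True
      then obtain b where "a = add_mset x b" by (meson mset_add)
      with a show ?thesis by auto
    next
      case False
      with a have "a \<subseteq># m"
        by (metis diff_single_trivial add_mset_remove_trivial subset_eq_diff_conv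
            add_mset_add_single)
      then show ?thesis by simp
    qed
  qed
  with add show ?case by (meson finite_UnI finite_imageI finite_subset)
qed

lemma finite_antidiagonal [simp]: "finite {(a, b). a + b = (m :: 'b multiset)}"
proof (rule finite_subset)
  show "{(a, b). a + b = m} \<subseteq> {a. a \<subseteq># m} \<times> {a. a \<subseteq># m}" by auto
qed (simp add: finite_submultisets)

instantiation mfps :: (ab_group_add) ab_group_add
begin

definition "0 = Mfps (\<lambda>_. 0)"
definition "f + g = Mfps (\<lambda>m. mcoeff f m + mcoeff g m)"
definition "- f = Mfps (\<lambda>m. - mcoeff f m)"
definition "f - g = Mfps (\<lambda>m. mcoeff f m - mcoeff g m)"

instance
  by standard
    (auto intro!: mfps_eqI simp: zero_mfps_def plus_mfps_def uminus_mfps_def minus_mfps_def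
      algebra_simps)

end

lemma mcoeff_zero [simp]: "mcoeff 0 m = 0"
  by (simp add: zero_mfps_def)

lemma mcoeff_add [simp]: "mcoeff (f + g) m = mcoeff f m + mcoeff g m"
  by (simp add: plus_mfps_def)

lemma mcoeff_uminus [simp]: "mcoeff (- f) m = - mcoeff f m"
  by (simp add: uminus_mfps_def)

lemma mcoeff_diff [simp]: "mcoeff (f - g) m = mcoeff f m - mcoeff g m"
  by (simp add: minus_mfps_def)

lemma mcoeff_sum [simp]: "mcoeff (sum f A) m = (\<Sum>i\<in>A. mcoeff (f i) m)"
  by (induction A rule: infinite_finite_induct) auto

instantiation mfps :: (comm_ring_1) comm_ring_1
begin

definition "1 = Mfps (\<lambda>m. if m = {#} then 1 else 0)"
definition "f * g = Mfps (\<lambda>m. \<Sum>(a, b) \<in> {(a, b). a + b = m}. mcoeff f a * mcoeff g b)"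

instance
proof
  fix f g h :: "'a mfps"
  show "f * g * h = f * (g * h)"
  proof (rule mfps_eqI)
    fix m :: "nat multiset"
    let ?S = "SIGMA p : {(a, b). a + b = m}. {(c, d). c + d = fst p}"
    let ?T = "SIGMA p : {(a, b). a + b = m}. {(c, d). c + d = snd p}"
    have "mcoeff (f * g * h) m =
        (\<Sum>p\<in>{(a, b). a + b = m}. \<Sum>q\<in>{(c, d). c + d = fst p}.
          mcoeff f (fst q) * mcoeff g (snd q) * mcoeff h (snd p))"
      by (simp add: times_mfps_def sum_distrib_right case_prod_unfold)
    also have "\<dots> = (\<Sum>(p, q)\<in>?S. mcoeff f (fst q) * mcoeff g (snd q) * mcoeff h (snd p))"
      by (rule sum.Sigma) (use finite_antidiagonal in auto)
    also have "\<dots> = (\<Sum>(p, q)\<in>?T. mcoeff f (fst p) * (mcoeff g (fst q) * mcoeff h (snd q)))"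
      by (rule sum.reindex_bij_witness[where
            i = "\<lambda>(p, q). ((fst p + fst q, snd q), (fst p, fst q))" and
            j = "\<lambda>(p, q). ((fst q, snd q + snd p), (snd q, snd p))"])
        (auto simp: ac_simps)
    also have "\<dots> = (\<Sum>p\<in>{(a, b). a + b = m}. \<Sum>q\<in>{(c, d). c + d = snd p}.
          mcoeff f (fst p) * (mcoeff g (fst q) * mcoeff h (snd q)))"
      by (rule sum.Sigma[symmetric]) (use finite_antidiagonal in auto)
    also have "\<dots> = mcoeff (f * (g * h)) m"
      by (simp add: times_mfps_def sum_distrib_left case_prod_unfold)
    finally show "mcoeff (f * g * h) m = mcoeff (f * (g * h)) m" .
  qed
  show "f * g = g * f"
  proof (rule mfps_eqI)
    fix m :: "nat multiset"
    show "mcoeff (f * g) m = mcoeff (g * f) m"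
      unfolding times_mfps_def mcoeff_Mfps
      by (rule sum.reindex_bij_witness[where i = prod.swap and j = prod.swap])
        (auto simp: ac_simps)
  qed
  show "1 * f = f"
  proof (rule mfps_eqI)
    fix m :: "nat multiset"
    have "mcoeff (1 * f) m =
        (\<Sum>p\<in>{(a, b). a + b = m}. if p = ({#}, m) then mcoeff f m else 0)"
      unfolding times_mfps_def one_mfps_def mcoeff_Mfps
      by (intro sum.cong refl) (clarsimp split: if_splits)
    then show "mcoeff (1 * f) m = mcoeff f m"
      by simp
  qed
  show "(f + g) * h = f * h + g * h"
    by (rule mfps_eqI)
      (simp add: times_mfps_def case_prod_unfold distrib_right sum.distrib)
  have "mcoeff (0 :: 'a mfps) {#} \<noteq> mcoeff 1 {#}"
    by (simp add: one_mfps_def)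
  then show "(0 :: 'a mfps) \<noteq> 1"
    by (rule contrapos_nn) (rule arg_cong)
qed

end

instantiation mfps :: (real_vector) real_vector
begin

definition "c *\<^sub>R f = Mfps (\<lambda>m. c *\<^sub>R mcoeff f m)"

instance
  by standard (auto intro!: mfps_eqI simp: scaleR_mfps_def algebra_simps)

end

lemma mcoeff_scaleR [simp]: "mcoeff (c *\<^sub>R f) m = c *\<^sub>R mcoeff f m"
  by (simp add: scaleR_mfps_def)

definition mconst :: "'a::zero \<Rightarrow> 'a mfps" where
  "mconst c = Mfps (\<lambda>m. if m = {#} then c else 0)"


section \<open>Power sums, Schur functions, plethysm by a power sum\<close>

text \<open>For $d \ge 1$ the coefficient of \<open>m\<close> in $p_d = \sum_i x_i^d$ is 1 if
  $m = x_i^d$ for some \<open>i\<close>, and 0 otherwise.\<close>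

definition psum :: "nat \<Rightarrow> 'a::zero_neq_one mfps" where
  "psum d = Mfps (\<lambda>m. if \<exists>i. m = replicate_mset d i then 1 else 0)"

definition partitions :: "nat \<Rightarrow> nat list set" where
  "partitions n = {mu. sorted_wrt (\<ge>) mu \<and> 0 \<notin> set mu \<and> sum_list mu = n}"

definition young_diagram :: "nat list \<Rightarrow> (nat \<times> nat) set" where
  "young_diagram mu = {(i, j). i < length mu \<and> j < mu ! i}"

definition semistandard_tableaux :: "nat list \<Rightarrow> (nat \<times> nat \<Rightarrow> nat) set" where
  "semistandard_tableaux mu =
    {T \<in> extensional (young_diagram mu).
      (\<forall>i j. (i, Suc j) \<in> young_diagram mu \<longrightarrow> T (i, j) \<le> T (i, Suc j)) \<and>
      (\<forall>i j. (Suc i, j) \<in> young_diagram mu \<longrightarrow> T (i, j) < T (Suc i, j))}"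

text \<open>$s_\mu = \sum_T \prod_{c} x_{T(c)}$: the coefficient of \<open>m\<close> counts the
  semistandard tableaux of shape \<open>mu\<close> and content \<open>m\<close>.\<close>

definition schur :: "nat list \<Rightarrow> 'a::semiring_1 mfps" where
  "schur mu = Mfps (\<lambda>m. of_nat (card {T \<in> semistandard_tableaux mu.
     image_mset T (mset_set (young_diagram mu)) = m}))"

text \<open>
  Plethysm $f[p_d]$ for $d \ge 1$ is the substitution $x_i \mapsto x_i^d$: the coefficient of
  $m'^d$ in $f[p_d]$ is that of $m'$ in \<open>f\<close>, and monomials that are not \<open>d\<close>-th
  powers do not occur.  (For $d \ge 1$ the index set of the sum has at most one element.)
  The lemmas below show that it is a ring homomorphism fixing the constants and sending
  $p_k$ to $p_{dk}$.
\<close>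

definition pleth_psum :: "'a::comm_ring_1 mfps \<Rightarrow> nat \<Rightarrow> 'a mfps" where
  "pleth_psum f d = Mfps (\<lambda>m. \<Sum>m' | repeat_mset d m' = m. mcoeff f m')"

lemma mcoeff_pleth_psum_repeat:
  "d > 0 \<Longrightarrow> mcoeff (pleth_psum f d) (repeat_mset d m) = mcoeff f m"
  by (simp add: pleth_psum_def repeat_mset_cancel1)

lemma mcoeff_pleth_psum_other:
  "\<nexists>m'. m = repeat_mset d m' \<Longrightarrow> mcoeff (pleth_psum f d) m = 0"
  by (auto simp: pleth_psum_def intro!: sum.neutral)

lemma pleth_psum_add: "pleth_psum (f + g) d = pleth_psum f d + pleth_psum g d"
  by (rule mfps_eqI) (simp add: pleth_psum_def sum.distrib)

lemma pleth_psum_mconst: "d > 0 \<Longrightarrow> pleth_psum (mconst c) d = mconst c"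
proof (rule mfps_eqI)
  fix m :: "nat multiset"
  assume d: "d > 0"
  show "mcoeff (pleth_psum (mconst c) d) m = mcoeff (mconst c) m"
  proof (cases "\<exists>m'. m = repeat_mset d m'")
    case True
    then obtain m' where m: "m = repeat_mset d m'" by blast
    show ?thesis
      using d unfolding m mcoeff_pleth_psum_repeat[OF d]
      by (simp add: mconst_def repeat_mset_eq_empty_iff)
  next
    case False
    then have "m \<noteq> {#}" by (metis repeat_mset_empty)
    with False show ?thesis by (simp add: mcoeff_pleth_psum_other mconst_def)
  qed
qed

lemma pleth_psum_psum: 
  assumes d: "d > 0"
  shows "pleth_psum (psum k) d = psum (d * k)"
proof (rule mfps_eqI)
  fix m :: "nat multiset"
  have rep: "repeat_mset d (replicate_mset k i) = replicate_mset (d * k) i" for i :: nat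
    by (rule multiset_eqI) simp
  show "mcoeff (pleth_psum (psum k) d :: 'a mfps) m = mcoeff (psum (d * k)) m"
  proof (cases "\<exists>m'. m = repeat_mset d m'")
    case True
    then obtain m' where m: "m = repeat_mset d m'" by blast
    have "m' = replicate_mset k i \<longleftrightarrow> m = replicate_mset (d * k) i" for i
      using d unfolding m rep[symmetric] by (simp add: repeat_mset_cancel1)
    then show ?thesis
      unfolding m mcoeff_pleth_psum_repeat[OF d] by (simp add: psum_def m)
  next
    case False
    then have "m \<noteq> replicate_mset (d * k) i" for i
      using rep by metis
    with False show ?thesis by (simp add: mcoeff_pleth_psum_other psum_def)
  qed
qed

lemma pleth_psum_mult:
  assumes d: "d > 0"
  shows "pleth_psum (f * g) d = pleth_psum f d * pleth_psum g d"
proof (rule mfps_eqI)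
  fix m :: "nat multiset"
  let ?D = "\<lambda>m. {(a, b). a + b = (m :: nat multiset)}"
  let ?r = "map_prod (repeat_mset d) (repeat_mset d) :: _ \<Rightarrow> nat multiset \<times> nat multiset"
  have eq: "mcoeff (pleth_psum f d * pleth_psum g d) m =
      (\<Sum>p\<in>?D m. mcoeff (pleth_psum f d) (fst p) * mcoeff (pleth_psum g d) (snd p))"
    by (simp add: times_mfps_def case_prod_unfold)
  have zero: "mcoeff (pleth_psum f d) (fst p) * mcoeff (pleth_psum g d) (snd p) = 0"
    if "p \<notin> range ?r" for p
  proof -
    have "(\<nexists>a. fst p = repeat_mset d a) \<or> (\<nexists>b. snd p = repeat_mset d b)"
    proof (rule ccontr)
      assume "\<not> ?thesis"
      then obtain a b where "p = ?r (a, b)" by (cases p) auto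
      with that show False by blast
    qed
    then have "mcoeff (pleth_psum f d) (fst p) = 0 \<or> mcoeff (pleth_psum g d) (snd p) = 0"
      by (blast intro: mcoeff_pleth_psum_other)
    then show ?thesis
      by auto
  qed
  show "mcoeff (pleth_psum (f * g) d) m = mcoeff (pleth_psum f d * pleth_psum g d) m"
  proof (cases "\<exists>m'. m = repeat_mset d m'")
    case True
    then obtain m' where m: "m = repeat_mset d m'" by blast
    have "inj ?r"
      using d by (auto simp: inj_on_def repeat_mset_cancel1)
    then have inj: "inj_on ?r (?D m')"
      using inj_on_subset by blast
    have img: "?r ` ?D m' \<subseteq> ?D m"
      by (auto simp: m simp flip: repeat_mset_distrib2)
    have "mcoeff (pleth_psum f d) (fst p) * mcoeff (pleth_psum g d) (snd p) = 0"
      if p: "p \<in> ?D m - ?r ` ?D m'" for p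
    proof (rule zero)
      show "p \<notin> range ?r"
      proof
        assume "p \<in> range ?r"
        then obtain a b where ab: "p = ?r (a, b)" by auto
        with p have "repeat_mset d (a + b) = repeat_mset d m'" by (simp add: m)
        with d have "a + b = m'" unfolding repeat_mset_cancel1 by simp
        with p ab show False by blast
      qed
    qed
    then have "mcoeff (pleth_psum f d * pleth_psum g d) m =
        (\<Sum>p\<in>?r ` ?D m'. mcoeff (pleth_psum f d) (fst p) * mcoeff (pleth_psum g d) (snd p))"
      unfolding eq by (intro sum.mono_neutral_right img finite_antidiagonal) blast
    also have "\<dots> = (\<Sum>p\<in>?D m'. mcoeff f (fst p) * mcoeff g (snd p))"
      by (simp add: sum.reindex[OF inj] mcoeff_pleth_psum_repeat[OF d])
    also have "\<dots> = mcoeff (pleth_psum (f * g) d) m"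
      unfolding m mcoeff_pleth_psum_repeat[OF d]
      by (simp add: times_mfps_def case_prod_unfold)
    finally show ?thesis by simp
  next
    case False
    have "mcoeff (pleth_psum f d * pleth_psum g d) m = 0"
      unfolding eq
    proof (intro sum.neutral ballI zero)
      fix p assume p: "p \<in> ?D m"
      show "p \<notin> range ?r"
        using False p by (auto simp flip: repeat_mset_distrib2)
    qed
    with False show ?thesis by (simp add: mcoeff_pleth_psum_other)
  qed
qed


section \<open>Induction from the cyclic group and the Frobenius characteristic\<close>

interpretation cfun: vector_space "\<lambda>(c :: complex) (f :: 'b \<Rightarrow> complex) x. c * f x"
  by unfold_locales (simp_all add: plus_fun_def distrib_left distrib_right mult.assoc)

definition trace_on :: "('b \<Rightarrow> complex) set \<Rightarrow> (('b \<Rightarrow> complex) \<Rightarrow> 'b \<Rightarrow> complex) \<Rightarrow> complex" where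
  "trace_on W A = (let B = (SOME B. cfun.independent B \<and> cfun.span B = W)
     in \<Sum>b\<in>B. cfun.representation B (A b) b)"

text \<open>The symmetric group $S_n$ consists of the \<open>w\<close> with \<open>w permutes {1..n}\<close>,
  multiplied by composition; $C_n$ is generated by the following \<open>n\<close>-cycle.\<close>

definition long_cycle :: "nat \<Rightarrow> nat \<Rightarrow> nat" where
  "long_cycle n = cycle_of_list [1..<n + 1]"

text \<open>
  The module $\mathrm{Ind}_{C_n}^{S_n} V_r$, as the space of functions $f$ on $S_n$ with
  $f(g h) = \chi(h)^{-1} f(g)$ for all $h \in C_n$, where $\chi(c^k) = e^{2\pi i r k/n}$ is the
  character of $V_r$; $w \in S_n$ acts by $(w f)(g) = f(w^{-1} g)$.  Functions on $S_n$ are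
  extended by 0 to all maps on the naturals.
\<close>

definition induced_module :: "nat \<Rightarrow> int \<Rightarrow> ((nat \<Rightarrow> nat) \<Rightarrow> complex) set" where
  "induced_module n r =
    {f. (\<forall>g. \<not> g permutes {1..n} \<longrightarrow> f g = 0) \<and>
        (\<forall>g k. g permutes {1..n} \<longrightarrow>
          f (g \<circ> long_cycle n ^^ k) = inverse (cis (2 * pi * of_int r * of_nat k / of_nat n)) * f g)}"

definition perm_action :: "(nat \<Rightarrow> nat) \<Rightarrow> ((nat \<Rightarrow> nat) \<Rightarrow> complex) \<Rightarrow> (nat \<Rightarrow> nat) \<Rightarrow> complex" where
  "perm_action w f = (\<lambda>g. f (inv w \<circ> g))"

definition induced_character :: "nat \<Rightarrow> int \<Rightarrow> (nat \<Rightarrow> nat) \<Rightarrow> complex" where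
  "induced_character n r w = trace_on (induced_module n r) (perm_action w)"

text \<open>$\mathrm{ch}(\chi) = \frac{1}{n!} \sum_{w \in S_n} \chi(w)\, p_{\mathrm{cyc}(w)}$, where
  $p_{\mathrm{cyc}(w)}$ is the product of the $p_{|C|}$ over the orbits $C$ of \<open>w\<close>
  on $\{1, \ldots, n\}$ (fixed points included).\<close>

definition frobenius_char :: "nat \<Rightarrow> ((nat \<Rightarrow> nat) \<Rightarrow> complex) \<Rightarrow> complex mfps" where
  "frobenius_char n \<chi> =
    (\<Sum>w | w permutes {1..n}. mconst (\<chi> w / fact n) * (\<Prod>C\<in>orbit w ` {1..n}. psum (card C)))"

definition foulkes :: "nat \<Rightarrow> int \<Rightarrow> complex mfps" where
  "foulkes n r = frobenius_char n (induced_character n r)"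

definition Qfun :: "nat \<Rightarrow> nat \<Rightarrow> complex mfps" where
  "Qfun n d = pleth_psum (foulkes (n div d) 1) d"


section \<open>Real and integral spans\<close>

definition R_space :: "nat \<Rightarrow> complex mfps set" where
  "R_space n = span ((\<lambda>d. psum d ^ (n div d)) ` {d. d dvd n})"

definition int_span :: "'i set \<Rightarrow> ('i \<Rightarrow> 'v::real_vector) \<Rightarrow> 'v set" where
  "int_span I b = {\<Sum>i\<in>I. of_int (c i) *\<^sub>R b i | c :: 'i \<Rightarrow> int. True}"

definition int_lattice :: "nat \<Rightarrow> complex mfps set" where
  "int_lattice n = int_span (partitions n) schur"

text \<open>$M = \bigoplus_{i \in I} \mathbb{Z}\, b_i$ as an internal direct sum of infinite cyclic
  groups, for finite \<open>I\<close>.\<close>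

definition is_int_direct_sum :: "'v::real_vector set \<Rightarrow> 'i set \<Rightarrow> ('i \<Rightarrow> 'v) \<Rightarrow> bool" where
  "is_int_direct_sum M I b \<longleftrightarrow>
    M = int_span I b \<and>
    (\<forall>c :: 'i \<Rightarrow> int. (\<Sum>i\<in>I. of_int (c i) *\<^sub>R b i) = 0 \<longrightarrow> (\<forall>i\<in>I. c i = 0))"

text \<open>All coefficients of \<open>F\<close> with respect to the family \<open>b\<close> are integers:
  \<open>F\<close> has a real expansion in the family, and every such expansion has integer
  coefficients (so nothing depends on a default value if \<open>b\<close> is not a basis).\<close>

definition integer_coeffs :: "'i set \<Rightarrow> ('i \<Rightarrow> 'v::real_vector) \<Rightarrow> 'v \<Rightarrow> bool" where
  "integer_coeffs I b F \<longleftrightarrow>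
    (\<exists>c :: 'i \<Rightarrow> real. F = (\<Sum>i\<in>I. c i *\<^sub>R b i)) \<and>
    (\<forall>c :: 'i \<Rightarrow> real. F = (\<Sum>i\<in>I. c i *\<^sub>R b i) \<longrightarrow> (\<forall>i\<in>I. c i \<in> \<int>))"

end

theory Submission
  imports Defs
begin

text \<open>
  All functions in sight have coefficients that count necklaces.  A word \<open>w\<close> of length
  \<open>n\<close> has a period \<open>t\<close> dividing \<open>n\<close>, its rotation class has exactly \<open>t\<close>
  elements, and so the number of words of content \<open>m\<close> and period \<open>t\<close> is \<open>t\<close> times a
  natural number, the number $N_t(m)$ of necklaces.  Averaging over the cyclic group gives
  $$[x^m]\, \ell_n^{(r)} = \frac 1n \sum_{k < n} e^{2 \pi i r k / n}\,
    |\{w : w \mbox{ has content } m \mbox{ and is fixed by the rotation by } k\}|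
    = \sum_{d \mid \gcd(n, r)} N_{n/d}(m),$$
  because the words of period $n/d$ are fixed by the multiples of $n/d$ only and a sum of roots of
  unity is $d$ or 0.  Repeating a word \<open>d\<close> times preserves its period, hence
  $[x^m]\, Q_{n,d} = N_{n/d}(m)$.  Counting the words fixed by one rotation gives
  $p_d^{n/d} = \sum_{d \mid e \mid n} \frac ne\, Q_{n,e}$.  These three formulas
  (\<open>mcoeff_foulkes\<close>, \<open>mcoeff_Qfun\<close>, \<open>psum_power_eq_sum_Qfun\<close>) show without any
  Moebius inversion that $\ell_n^{(e)} = \sum_{d \mid e} Q_{n,d}$ and that the $Q_{n,d}$ span
  the same real space as the $p_d^{n/d}$.

  Integral $x_d$ give Schur-integral functions: $\sum_d x_d Q_{n,d}$ is then symmetric with integer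
  monomial coefficients, and such a function of degree \<open>n\<close> lies in the Schur lattice.  The latter
  rests on the symmetry of Schur functions (Bender-Knuth involutions) and on the unitriangularity of
  the Kostka matrix.  Its order is the plain rank $\sum_i i \mu_i$: the entries of a tableau in
  row \<open>i\<close> are at least \<open>i\<close>, so a tableau of shape $\lambda$ and content $\mu$ has
  $\sum_i i \lambda_i \le \sum_i i \mu_i$, with equality for one tableau only.

  Conversely, Schur-integral functions have integer monomial coefficients.  The coefficient of
  $x_0^e x_1^{n - e}$ in $Q_{n,d}$ vanishes unless $d \mid e$, since a \<open>d\<close>-fold repetition
  contains each letter a multiple of \<open>d\<close> times, and it is 1 for $d = e$, since a word of length
  $n/e$ with a single letter 0 is primitive and all such words are rotations of each other.  So these
  coefficients form a unitriangular integer matrix, which forces all $x_d$ to be integers.  The passage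
  from the $Q_{n,d}$ to the $\ell_n^{(e)}$ is unitriangular as well.
\<close>

section \<open>Unitriangular integer matrices\<close>

text \<open>
  Back substitution.  The subgroup \<open>S\<close> of the reals is a parameter because two instances are
  wanted: the integers for integrality, and \<open>{0}\<close> for linear independence.
\<close>
lemma unitriangular_coeffs_in_subgroup:
  fixes c :: "'i \<Rightarrow> real" and K :: "'i \<Rightarrow> 'i \<Rightarrow> int" and rk :: "'i \<Rightarrow> nat"
  assumes I: "finite I" and diag: "\<And>i. i \<in> I \<Longrightarrow> K i i = 1"
    and tri: "\<And>i j. i \<in> I \<Longrightarrow> j \<in> I \<Longrightarrow> i \<noteq> j \<Longrightarrow> \<not> rk i < rk j \<Longrightarrow> K i j = 0"
    and S0: "0 \<in> S" and S: "\<And>x y k. x \<in> S \<Longrightarrow> y \<in> S \<Longrightarrow> x - y * of_int k \<in> S"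
    and sums: "\<And>j. j \<in> I \<Longrightarrow> (\<Sum>i\<in>I. c i * of_int (K i j)) \<in> S"
    and "j \<in> I"
  shows "c j \<in> S"
  using \<open>j \<in> I\<close>
proof (induction "rk j" arbitrary: j rule: less_induct)
  case less
  have "x - (\<Sum>i\<in>A. c i * of_int (K i j)) \<in> S" if "finite A" "x \<in> S" "A \<subseteq> I - {j}" for A x
    using that
  proof (induction A)
    case (insert i A)
    have "(x - (\<Sum>i\<in>A. c i * of_int (K i j))) - c i * of_int (K i j) \<in> S"
    proof (cases "rk i < rk j")
      case True
      with insert less show ?thesis by (intro S) auto
    next
      case False
      then have "K i j = 0" using insert.prems less.prems by (intro tri) auto
      with insert show ?thesis by simp
    qed
    with insert.hyps show ?case by (simp add: algebra_simps)
  qed simp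
  from this[of "I - {j}" "\<Sum>i\<in>I. c i * of_int (K i j)"]
  have "(\<Sum>i\<in>I. c i * of_int (K i j)) - (\<Sum>i\<in>I - {j}. c i * of_int (K i j)) \<in> S"
    using I sums less.prems by blast
  also have "(\<Sum>i\<in>I. c i * of_int (K i j)) - (\<Sum>i\<in>I - {j}. c i * of_int (K i j)) = c j"
    using I less.prems diag by (simp add: sum.remove)
  finally show ?case .
qed

text \<open>
  Adding an index of largest rank to \<open>I\<close> affects only its own equation, which has the
  coefficient 1 at the new unknown.
\<close>
lemma unitriangular_solvable:
  fixes a :: "'i \<Rightarrow> int" and K :: "'i \<Rightarrow> 'i \<Rightarrow> int" and rk :: "'i \<Rightarrow> nat"
  assumes "finite I" and "\<And>i. i \<in> I \<Longrightarrow> K i i = 1"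
    and "\<And>i j. i \<in> I \<Longrightarrow> j \<in> I \<Longrightarrow> i \<noteq> j \<Longrightarrow> \<not> rk i < rk j \<Longrightarrow> K i j = 0"
  obtains c :: "'i \<Rightarrow> int" where "\<And>j. j \<in> I \<Longrightarrow> (\<Sum>i\<in>I. c i * K i j) = a j"
proof -
  have "\<exists>c :: 'i \<Rightarrow> int. \<forall>j\<in>I. (\<Sum>i\<in>I. c i * K i j) = a j"
    using assms
  proof (induction I rule: finite_ranking_induct[where f = rk])
    case (insert x I)
    have "\<exists>c. \<forall>j\<in>I. (\<Sum>i\<in>I. c i * K i j) = a j"
      by (intro insert.IH insert.prems) auto
    then obtain c where c: "\<And>j. j \<in> I \<Longrightarrow> (\<Sum>i\<in>I. c i * K i j) = a j"
      by blast
    show ?case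
    proof (cases "x \<in> I")
      case True
      then show ?thesis using c by (auto simp: insert_absorb)
    next
      case False
      define c' where "c' = c(x := a x - (\<Sum>i\<in>I. c i * K i x))"
      have "(\<Sum>i\<in>I. c' i * K i j) = (\<Sum>i\<in>I. c i * K i j)" for j
        using False by (intro sum.cong) (auto simp: c'_def)
      moreover have "K x j = 0" if "j \<in> I" for j
        using that False insert.prems(2)[of x j] insert.hyps(2)[of j] by fastforce
      ultimately have "\<forall>j\<in>insert x I. (\<Sum>i\<in>insert x I. c' i * K i j) = a j"
        using False insert.hyps(1) insert.prems(1)[of x] c by (auto simp: c'_def)
      then show ?thesis by blast
    qed
  qed simp
  with that show ?thesis by blast
qed

text \<open>
  A unitriangular integer change of basis preserves integral spans, independence and integrality of
  coordinates.
\<close>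
lemma
  fixes b l :: "'i \<Rightarrow> 'v::real_vector" and K :: "'i \<Rightarrow> 'i \<Rightarrow> int" and rk :: "'i \<Rightarrow> nat"
  assumes I: "finite I" and diag: "\<And>i. i \<in> I \<Longrightarrow> K i i = 1"
    and tri: "\<And>i j. i \<in> I \<Longrightarrow> j \<in> I \<Longrightarrow> i \<noteq> j \<Longrightarrow> \<not> rk i < rk j \<Longrightarrow> K i j = 0"
    and l: "\<And>i. i \<in> I \<Longrightarrow> l i = (\<Sum>j\<in>I. of_int (K i j) *\<^sub>R b j)"
    and indep: "\<And>x. (\<Sum>i\<in>I. x i *\<^sub>R b i) = 0 \<Longrightarrow> \<forall>i\<in>I. x i = 0"
  shows int_span_unitriangular: "int_span I l = int_span I b"
    and independent_unitriangular: "(\<Sum>i\<in>I. c i *\<^sub>R l i) = 0 \<Longrightarrow> j \<in> I \<Longrightarrow> c j = 0"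
    and integer_coeffs_unitriangular:
      "integer_coeffs I l (\<Sum>i\<in>I. x i *\<^sub>R b i) \<longleftrightarrow> (\<forall>i\<in>I. x i \<in> \<int>)"
proof -
  have expand: "(\<Sum>i\<in>I. c i *\<^sub>R l i) = (\<Sum>j\<in>I. (\<Sum>i\<in>I. c i * of_int (K i j)) *\<^sub>R b j)" for c
  proof -
    have "(\<Sum>i\<in>I. c i *\<^sub>R l i) = (\<Sum>i\<in>I. \<Sum>j\<in>I. (c i * of_int (K i j)) *\<^sub>R b j)"
      by (intro sum.cong refl) (simp add: l scaleR_sum_right)
    also have "\<dots> = (\<Sum>j\<in>I. \<Sum>i\<in>I. (c i * of_int (K i j)) *\<^sub>R b j)"
      by (rule sum.swap)
    finally show ?thesis by (simp add: scaleR_sum_left)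
  qed
  have solve: "\<exists>c :: 'i \<Rightarrow> int. (\<Sum>i\<in>I. of_int (c i) *\<^sub>R l i) = (\<Sum>i\<in>I. of_int (a i) *\<^sub>R b i)" for a
  proof -
    obtain c :: "'i \<Rightarrow> int" where c: "\<And>j. j \<in> I \<Longrightarrow> (\<Sum>i\<in>I. c i * K i j) = a j"
      using unitriangular_solvable[of I K rk a, OF I diag tri] by blast
    have "(\<Sum>i\<in>I. of_int (c i) *\<^sub>R l i) = (\<Sum>j\<in>I. of_int (\<Sum>i\<in>I. c i * K i j) *\<^sub>R b j)"
      unfolding expand by simp
    also have "\<dots> = (\<Sum>j\<in>I. of_int (a j) *\<^sub>R b j)"
      by (intro sum.cong) (simp_all only: c)
    finally show ?thesis by blast
  qed
  show "int_span I l = int_span I b"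
  proof
    show "int_span I l \<subseteq> int_span I b"
    proof
      fix v assume "v \<in> int_span I l"
      then obtain c :: "'i \<Rightarrow> int" where "v = (\<Sum>i\<in>I. of_int (c i) *\<^sub>R l i)"
        by (auto simp: int_span_def)
      then have "v = (\<Sum>j\<in>I. of_int (\<Sum>i\<in>I. c i * K i j) *\<^sub>R b j)"
        unfolding expand by simp
      then show "v \<in> int_span I b"
        unfolding int_span_def by (intro CollectI exI conjI TrueI)
    qed
    show "int_span I b \<subseteq> int_span I l"
    proof
      fix v assume "v \<in> int_span I b"
      then obtain a :: "'i \<Rightarrow> int" where "v = (\<Sum>i\<in>I. of_int (a i) *\<^sub>R b i)"
        by (auto simp: int_span_def)
      moreover obtain c :: "'i \<Rightarrow> int" where "(\<Sum>i\<in>I. of_int (c i) *\<^sub>R l i) = (\<Sum>i\<in>I. of_int (a i) *\<^sub>R b i)"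
        using solve by blast
      ultimately have "v = (\<Sum>i\<in>I. of_int (c i) *\<^sub>R l i)"
        by simp
      then show "v \<in> int_span I l"
        unfolding int_span_def by (intro CollectI exI conjI TrueI)
    qed
  qed
  have triangular: "c j \<in> S" if "0 \<in> S" "\<And>a b k. a \<in> S \<Longrightarrow> b \<in> S \<Longrightarrow> a - b * of_int k \<in> S"
    "\<And>j. j \<in> I \<Longrightarrow> (\<Sum>i\<in>I. c i * of_int (K i j)) \<in> S" "j \<in> I" for c :: "'i \<Rightarrow> real" and S j
    using unitriangular_coeffs_in_subgroup[of I K rk S c j, OF I diag tri that] by blast
  show "c j = 0" if zero: "(\<Sum>i\<in>I. c i *\<^sub>R l i) = 0" and "j \<in> I" for c j
  proof -
    have "\<forall>j\<in>I. (\<Sum>i\<in>I. c i * of_int (K i j)) = 0"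
      using zero unfolding expand by (rule indep)
    then show ?thesis
      using triangular[of "{0}" c j] \<open>j \<in> I\<close> by simp
  qed
  have coords: "x j = (\<Sum>i\<in>I. c i * of_int (K i j))"
    if eq: "(\<Sum>i\<in>I. x i *\<^sub>R b i) = (\<Sum>i\<in>I. c i *\<^sub>R l i)" and "j \<in> I" for x c j
  proof -
    have "(\<Sum>j\<in>I. (x j - (\<Sum>i\<in>I. c i * of_int (K i j))) *\<^sub>R b j) = 0"
      using eq unfolding expand by (simp add: scaleR_diff_left sum_subtractf)
    from indep[OF this] \<open>j \<in> I\<close> show ?thesis by simp
  qed
  show "integer_coeffs I l (\<Sum>i\<in>I. x i *\<^sub>R b i) \<longleftrightarrow> (\<forall>i\<in>I. x i \<in> \<int>)"
  proof
    assume "integer_coeffs I l (\<Sum>i\<in>I. x i *\<^sub>R b i)"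
    then obtain c where c: "(\<Sum>i\<in>I. x i *\<^sub>R b i) = (\<Sum>i\<in>I. c i *\<^sub>R l i)" "\<forall>i\<in>I. c i \<in> \<int>"
      unfolding integer_coeffs_def by blast
    then show "\<forall>i\<in>I. x i \<in> \<int>"
      by (auto simp: coords[OF c(1)] intro!: Ints_sum Ints_mult)
  next
    assume int: "\<forall>i\<in>I. x i \<in> \<int>"
    then have floor: "(\<Sum>i\<in>I. x i *\<^sub>R b i) = (\<Sum>i\<in>I. of_int \<lfloor>x i\<rfloor> *\<^sub>R b i)"
      by (intro sum.cong) (auto elim: Ints_cases)
    obtain c :: "'i \<Rightarrow> int" where "(\<Sum>i\<in>I. of_int (c i) *\<^sub>R l i) = (\<Sum>i\<in>I. x i *\<^sub>R b i)"
      unfolding floor using solve[of "\<lambda>i. \<lfloor>x i\<rfloor>"] by blast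
    then have "\<exists>c. (\<Sum>i\<in>I. x i *\<^sub>R b i) = (\<Sum>i\<in>I. c i *\<^sub>R l i)"
      by (intro exI[of _ "\<lambda>i. of_int (c i)"]) simp
    moreover have "c j \<in> \<int>"
      if eq: "(\<Sum>i\<in>I. x i *\<^sub>R b i) = (\<Sum>i\<in>I. c i *\<^sub>R l i)" and j: "j \<in> I" for c j
    proof -
      have "(\<Sum>i\<in>I. c i * of_int (K i j)) \<in> \<int>" if "j \<in> I" for j
        using int that by (simp flip: coords[OF eq that])
      then show ?thesis
        using triangular[of \<int> c j] j by simp
    qed
    ultimately show "integer_coeffs I l (\<Sum>i\<in>I. x i *\<^sub>R b i)"
      unfolding integer_coeffs_def by blast
  qed
qed


section \<open>Words, periods and necklaces\<close>

definition period :: "'b list \<Rightarrow> nat" where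
  "period w = (LEAST t. t > 0 \<and> rotate t w = w)"

lemma
  shows period_pos: "period w > 0"
    and rotate_period: "rotate (period w) w = w"
proof -
  have "length w > 0 \<and> rotate (length w) w = w \<or> (1::nat) > 0 \<and> rotate 1 w = w"
    using rotate_id[of "length w" w] by (cases "w = []") auto
  then have "\<exists>t. t > 0 \<and> rotate t w = w" by blast
  from LeastI_ex[OF this] show "period w > 0" "rotate (period w) w = w"
    unfolding period_def by simp_all
qed

lemma rotate_multiple_period: "rotate (q * period w) w = w"
  by (induction q) (simp_all flip: rotate_rotate add: rotate_period)

text \<open>
  If the rotation by \<open>k\<close> fixes \<open>w\<close>, then so does the rotation by the remainder of \<open>k\<close>
  modulo the period, which is 0 because the period is least.
\<close>
lemma rotate_eq_self_iff: "rotate k w = w \<longleftrightarrow> period w dvd k"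
proof
  assume "rotate k w = w"
  have "rotate (k mod period w) w = rotate (k mod period w) (rotate (k div period w * period w) w)"
    by (simp only: rotate_multiple_period)
  also have "\<dots> = rotate k w"
    unfolding rotate_rotate by simp
  finally have "rotate (k mod period w) w = w"
    using \<open>rotate k w = w\<close> by simp
  moreover have "k mod period w < period w"
    using period_pos by (rule mod_less_divisor)
  ultimately have "k mod period w = 0"
    using not_less_Least[of "k mod period w" "\<lambda>t. t > 0 \<and> rotate t w = w"]
    by (simp flip: period_def)
  then show "period w dvd k" by auto
next
  assume "period w dvd k"
  then show "rotate k w = w"
    by (auto simp: dvd_def mult.commute rotate_multiple_period)
qed

lemma period_dvd_length: "period w dvd length w"
  using rotate_eq_self_iff[of "length w" w] by simp

lemma period_eqI: "(\<And>k. rotate k w = w \<longleftrightarrow> rotate k v = v) \<Longrightarrow> period w = period v"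
  unfolding rotate_eq_self_iff by (meson dvd_antisym dvd_refl)

lemma rotate_inject: "rotate j v = rotate j w \<longleftrightarrow> v = w"
proof
  assume eq: "rotate j v = rotate j w"
  then have len: "length v = length w"
    by (metis length_rotate)
  have "rotate (length v * j) u = u" if "length u = length v" for u :: "'a list"
    using that by (simp add: rotate_eq_self_iff period_dvd_length flip: that)
  then have undo: "rotate ((length v - 1) * j) (rotate j u) = u" if "length u = length v" for u :: "'a list"
    using that by (cases "length v") (auto simp: rotate_rotate add.commute)
  show "v = w"
    using undo[of v] undo[of w] eq len by simp
qed simp

lemma period_rotate: "period (rotate j w) = period w"
proof (rule period_eqI)
  fix k
  have "rotate k (rotate j w) = rotate j (rotate k w)"
    by (simp add: rotate_rotate add.commute)
  then show "rotate k (rotate j w) = rotate j w \<longleftrightarrow> rotate k w = w"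
    by (simp add: rotate_inject)
qed

lemma period_map: "inj f \<Longrightarrow> period (map f w) = period w"
  by (rule period_eqI) (simp add: rotate_map)

lemma mset_rotate: "mset (rotate k w) = mset (w :: 'b list)"
proof -
  have "mset (rotate1 v) = mset v" for v :: "'b list"
    by (cases v) simp_all
  then show ?thesis by (induction k) simp_all
qed

definition words :: "nat \<Rightarrow> 'b multiset \<Rightarrow> 'b list set" where
  "words t m = {w. mset w = m \<and> period w = t}"

lemma finite_words [simp]: "finite (words t m)"
proof (rule finite_subset)
  show "words t m \<subseteq> permutations_of_multiset m"
    by (auto simp: words_def permutations_of_multiset_def)
qed simp

text \<open>Rotation acts on the words of period \<open>t\<close> with all orbits of size \<open>t\<close>.\<close>

lemma period_dvd_card_words: "t dvd card (words t m)"
proof (rule equiv_imp_dvd_card)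
  let ?r = "{(v, w). v \<in> words t m \<and> w \<in> words t m \<and> (\<exists>k. w = rotate k v)}"
  have undo: "\<exists>j. v = rotate j (rotate k v)" if "v \<in> words t m" for k v
  proof
    have t: "period v = t" "t > 0"
      using that period_pos by (auto simp: words_def)
    have "rotate ((t - 1) * k) (rotate k v) = rotate (t * k) v"
      using t by (cases t) (simp_all add: rotate_rotate add.commute)
    also have "\<dots> = v"
      using t by (simp add: rotate_eq_self_iff)
    finally show "v = rotate ((t - 1) * k) (rotate k v)" ..
  qed
  show "equiv (words t m) ?r"
  proof (rule equivI)
    show "refl_on (words t m) ?r"
      by (auto simp: refl_on_def intro!: exI[of _ 0])
    show "sym ?r"
      using undo by (fastforce simp: sym_def)
    show "trans ?r"
      by (auto simp: trans_def rotate_rotate)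
  qed auto
  fix X assume "X \<in> words t m // ?r"
  then obtain v where v: "v \<in> words t m" and X: "X = ?r `` {v}"
    by (auto simp: quotient_def)
  have t: "period v = t" "t > 0"
    using v period_pos by (auto simp: words_def)
  have mem: "rotate k v \<in> words t m" for k
    using v by (simp add: words_def period_rotate mset_rotate)
  have "X = (\<lambda>k. rotate k v) ` {..<t}"
  proof
    show "X \<subseteq> (\<lambda>k. rotate k v) ` {..<t}"
    proof
      fix w assume "w \<in> X"
      then obtain k where "w = rotate k v" using X by auto
      also have "\<dots> = rotate (k mod t) (rotate (k div t * t) v)"
        unfolding rotate_rotate by simp
      also have "rotate (k div t * t) v = v"
        using t by (simp add: rotate_eq_self_iff)
      finally show "w \<in> (\<lambda>k. rotate k v) ` {..<t}" using t by auto
    qed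
  qed (use v mem X in auto)
  moreover have "inj_on (\<lambda>k. rotate k v) {..<t}"
  proof (rule linorder_inj_onI')
    fix i j assume "i \<in> {..<t}" "j \<in> {..<t}" "i < j"
    then have "\<not> t dvd j - i"
      by (auto dest: dvd_imp_le)
    then have "rotate (j - i) v \<noteq> v"
      using t by (simp add: rotate_eq_self_iff)
    then have "rotate i (rotate (j - i) v) \<noteq> rotate i v"
      by (simp add: rotate_inject)
    then show "rotate i v \<noteq> rotate j v"
      using \<open>i < j\<close> by (simp add: rotate_rotate)
  qed
  ultimately show "t dvd card X"
    by (simp add: card_image)
qed simp

definition repeat_word :: "nat \<Rightarrow> 'b list \<Rightarrow> 'b list" where
  "repeat_word d u = concat (replicate d u)"

lemma length_repeat_word [simp]: "length (repeat_word d u) = d * length u"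
  by (induction d) (simp_all add: repeat_word_def)

lemma mset_repeat_word [simp]: "mset (repeat_word d u) = repeat_mset d (mset u)"
  by (induction d) (simp_all add: repeat_word_def)

lemma repeat_word_inject: "d > 0 \<Longrightarrow> repeat_word d u = repeat_word d v \<longleftrightarrow> u = v"
proof
  assume "d > 0" and eq: "repeat_word d u = repeat_word d v"
  then have "length u = length v"
    by (metis length_repeat_word mult_cancel1 not_gr_zero)
  with \<open>d > 0\<close> eq show "u = v"
    by (cases d) (auto simp: repeat_word_def)
qed simp

text \<open>Repetition commutes with rotation, so it preserves the period.\<close>
lemma rotate_repeat_word: "rotate k (repeat_word d u) = repeat_word d (rotate k u)"
proof -
  have shift: "concat (replicate d (x # xs)) @ [x] = x # concat (replicate d (xs @ [x]))" for d x and xs :: "'a list"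
    by (induction d) simp_all
  have "rotate1 (repeat_word d u) = repeat_word d (rotate1 u)" for u :: "'a list"
    by (cases u; cases d) (simp_all add: repeat_word_def shift)
  then show ?thesis
    by (induction k) simp_all
qed

lemma period_repeat_word: "d > 0 \<Longrightarrow> period (repeat_word d u) = period u"
  by (rule period_eqI) (simp add: rotate_repeat_word repeat_word_inject)

text \<open>
  A word fixed by the rotation by \<open>N\<close> satisfies \<open>v @ r = r @ v\<close>, where \<open>v\<close> is its
  prefix of length \<open>N\<close> and \<open>r\<close> is the rest; so \<open>v\<close> can be split off from \<open>r\<close>
  again and again.
\<close>
lemma repeat_word_take:
  assumes "rotate N w = w" "length w = d * N"
  shows "repeat_word d (take N w) = w"
proof (cases d)
  case 0
  with assms show ?thesis by (simp add: repeat_word_def)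
next
  case (Suc k)
  have comm: "r = repeat_word k v" if "v @ r = r @ v" "length r = k * length v" for k and v r :: "'a list"
    using that
  proof (induction k arbitrary: r)
    case (Suc k)
    have "take (length v) (v @ r) = take (length v) r"
      unfolding Suc.prems(1) using Suc.prems(2) by simp
    then have r: "r = v @ drop (length v) r"
      using append_take_drop_id[of "length v" r] by simp
    define r' where "r' = drop (length v) r"
    have r: "r = v @ r'"
      using r by (simp add: r'_def)
    have "r' = repeat_word k v"
      using Suc.prems unfolding r by (intro Suc.IH) auto
    with r show ?case by (simp add: repeat_word_def)
  qed (simp add: repeat_word_def)
  have "rotate N w = drop N w @ take N w"
    using Suc assms(2) by (cases "length w = N") (auto simp: rotate_drop_take)
  then have "drop N w = repeat_word k (take N w)"
    using Suc assms by (intro comm) auto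
  then show ?thesis
    using append_take_drop_id[of N w] Suc by (simp add: repeat_word_def)
qed

lemma card_words_repeat:
  assumes "d > 0" "t dvd size m"
  shows "card (words t (repeat_mset d m)) = card (words t m)"
proof -
  have "bij_betw (repeat_word d) (words t m) (words t (repeat_mset d m))"
    unfolding bij_betw_def
  proof
    show "inj_on (repeat_word d) (words t m)"
      using assms by (auto simp: inj_on_def repeat_word_inject)
    have "w \<in> repeat_word d ` words t m" if w: "w \<in> words t (repeat_mset d m)" for w
    proof -
      have w': "mset w = repeat_mset d m" "period w = t"
        using w by (simp_all add: words_def)
      have len: "length w = d * size m"
        using w'(1) size_mset[of w] by simp
      have "rotate (size m) w = w"
        using w' \<open>t dvd size m\<close> by (simp add: rotate_eq_self_iff)
      then have eq: "repeat_word d (take (size m) w) = w"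
        using len by (rule repeat_word_take)
      then have "repeat_mset d (mset (take (size m) w)) = repeat_mset d m"
        using w' mset_repeat_word[of d "take (size m) w"] by simp
      then have "take (size m) w \<in> words t m"
        using w'(2) eq assms(1) period_repeat_word[OF assms(1), of "take (size m) w"]
        by (simp add: words_def repeat_mset_cancel1)
      then show ?thesis using eq by (metis imageI)
    qed
    moreover have "repeat_word d ` words t m \<subseteq> words t (repeat_mset d m)"
      using assms by (auto simp: words_def period_repeat_word)
    ultimately show "repeat_word d ` words t m = words t (repeat_mset d m)"
      by blast
  qed
  then show ?thesis by (simp add: bij_betw_same_card)
qed

lemma words_eq_empty:
  assumes "\<nexists>m'. m = repeat_mset d m'" "size m = d * N" "t dvd N"
  shows "words t m = {}"
proof -
  have False if "w \<in> words t m" for w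
  proof -
    have w: "mset w = m" "period w = t"
      using that by (simp_all add: words_def)
    then have "repeat_word d (take N w) = w"
      using assms(2,3) by (intro repeat_word_take) (auto simp: rotate_eq_self_iff)
    then have "m = repeat_mset d (mset (take N w))"
      using w(1) by (metis mset_repeat_word)
    with assms(1) show False by blast
  qed
  then show ?thesis by blast
qed

definition necklaces :: "nat \<Rightarrow> 'b multiset \<Rightarrow> nat" where
  "necklaces t m = card (words t m) div t"

lemma card_words_eq: "card (words t m) = t * necklaces t m"
  by (simp add: necklaces_def period_dvd_card_words)

text \<open>
  The possible periods of a word of length \<open>n\<close> are the \<open>n div d\<close>; they are indexed by the
  codivisor \<open>d\<close>, because this is the index of the matching \<open>Qfun n d\<close>.
\<close>
lemma card_words_fixed_by_rotation:
  assumes n: "n \<ge> 1" and m: "size m = n"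
  shows "card {u. length u = n \<and> mset u = m \<and> rotate k u = u} =
    (\<Sum>d | d dvd n \<and> n div d dvd k. (n div d) * necklaces (n div d) m)"
proof -
  let ?D = "{d. d dvd n \<and> n div d dvd k}"
  have fin: "finite ?D"
    using n by simp
  have "{u. length u = n \<and> mset u = m \<and> rotate k u = u} = (\<Union>d\<in>?D. words (n div d) m)"
  proof (intro equalityI subsetI)
    fix u assume "u \<in> {u. length u = n \<and> mset u = m \<and> rotate k u = u}"
    then have u: "length u = n" "mset u = m" "period u dvd k"
      by (auto simp: rotate_eq_self_iff)
    then obtain d where d: "n = period u * d"
      using period_dvd_length[of u] by auto
    then have "n div d = period u"
      using n by auto
    then show "u \<in> (\<Union>d\<in>?D. words (n div d) m)"
      using u d by (intro UN_I[of d]) (auto simp: words_def)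
  qed (use m in \<open>auto simp: words_def rotate_eq_self_iff simp flip: size_mset\<close>)
  moreover have "words (n div d) m \<inter> words (n div d') m = {}"
    if "d \<in> ?D" "d' \<in> ?D" "d \<noteq> d'" for d d'
  proof -
    have "n div d \<noteq> n div d'"
      using that n by (metis (no_types, lifting) dvd_div_eq_mult dvd_mult_div_cancel
          mem_Collect_eq mult_cancel1 mult_eq_0_iff nat_mult_eq_cancel_disj not_one_le_zero)
    then show ?thesis by (auto simp: words_def)
  qed
  ultimately show ?thesis
    using fin by (simp add: card_UN_disjoint card_words_eq)
qed

lemma no_words_of_wrong_length: "size m \<noteq> n \<Longrightarrow> {u. length u = n \<and> mset u = m \<and> P u} = {}"
  by auto

lemma necklaces_image_mset:
  fixes \<sigma> :: "'b \<Rightarrow> 'b"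
  assumes \<sigma>: "bij \<sigma>"
  shows "necklaces t (image_mset \<sigma> m) = necklaces t m"
proof -
  have inv: "\<sigma> (inv \<sigma> x) = x" "inv \<sigma> (\<sigma> x) = x" for x
    using \<sigma> by (simp_all add: bij_is_surj bij_is_inj surj_f_inv_f)
  have period: "period (map \<sigma> w) = period w" "period (map (inv \<sigma>) w) = period w" for w
    using \<sigma> by (simp_all add: period_map bij_is_inj bij_imp_bij_inv)
  have "bij_betw (map \<sigma>) (words t m) (words t (image_mset \<sigma> m))"
    by (rule bij_betw_byWitness[where f' = "map (inv \<sigma>)"])
      (auto simp: words_def inv period comp_def multiset.map_comp)
  then show ?thesis by (simp add: necklaces_def bij_betw_same_card)
qed

text \<open>The number of repetitions divides the multiplicity of each letter.\<close>
lemma period_word_with_simple_letter: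
  assumes "count (mset w) x = 1"
  shows "period w = length w"
proof -
  obtain q where q: "length w = period w * q"
    using period_dvd_length by (rule dvdE)
  then have "repeat_word q (take (period w) w) = w"
    using rotate_period by (intro repeat_word_take) simp_all
  then have "q * count (mset (take (period w) w)) x = 1"
    using assms by (metis count_repeat_mset mset_repeat_word)
  then show ?thesis using q by simp
qed

text \<open>The monomial $x_0^e x_1^{n - e}$, presented as the \<open>e\<close>-th power of $x_0 x_1^{n/e - 1}$.\<close>
definition test_monomial :: "nat \<Rightarrow> nat \<Rightarrow> nat multiset" where
  "test_monomial n e = repeat_mset e (add_mset 0 (replicate_mset (n div e - 1) 1))"

lemma size_test_monomial: "n \<ge> 1 \<Longrightarrow> e dvd n \<Longrightarrow> size (test_monomial n e) = n"
  by (auto simp: test_monomial_def algebra_simps elim!: dvdE)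

lemma necklaces_test_monomial_diagonal:
  assumes n: "n \<ge> 1" and e: "e dvd n"
  shows "necklaces (n div e) (test_monomial n e) = 1"
proof -
  define N where "N = n div e"
  have pos: "N > 0" "e > 0"
    using n e by (auto simp: N_def intro: Nat.gr0I)
  let ?m = "add_mset 0 (replicate_mset (N - 1) 1) :: nat multiset"
  have size: "size ?m = N" using pos by simp
  have "period w = N" if "mset w = ?m" for w
  proof -
    have "period w = length w"
      by (rule period_word_with_simple_letter[of _ 0]) (simp add: that)
    then show ?thesis using that size by (metis size_mset)
  qed
  then have "words N ?m = permutations_of_multiset ?m"
    by (auto simp: words_def permutations_of_multiset_def)
  moreover have "permutations_of_multiset (replicate_mset (N - 1) (1::nat)) = {replicate (N - 1) 1}"
  proof -
    have "w = replicate (N - 1) 1" if "mset w = replicate_mset (N - 1) 1" for w :: "nat list"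
      using that size_mset[of w] set_mset_mset[of w] by (intro replicate_eqI) (auto split: if_splits)
    then show ?thesis by (auto simp: permutations_of_multiset_def)
  qed
  then have singleton: "card (permutations_of_multiset (replicate_mset (N - 1) (1::nat))) = 1"
    by simp
  have "card (permutations_of_multiset ?m) = N"
    using card_permutations_of_multiset_remove_aux[of 0 ?m] size singleton by simp
  ultimately have "card (words N (test_monomial n e)) = N"
    using pos card_words_repeat[of e N ?m] size by (simp add: test_monomial_def flip: N_def)
  then show ?thesis
    using pos by (simp add: necklaces_def flip: N_def)
qed

lemma necklaces_test_monomial_eq_0:
  assumes n: "n \<ge> 1" and "d dvd n" "e dvd n" "\<not> d dvd e"
  shows "necklaces (n div d) (test_monomial n e) = 0"
proof -
  have "count (test_monomial n e) 0 = e"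
    by (simp add: test_monomial_def)
  then have "\<nexists>m. test_monomial n e = repeat_mset d m"
    using \<open>\<not> d dvd e\<close> by (metis count_repeat_mset dvd_triv_left)
  then have "words (n div d) (test_monomial n e) = {}"
    by (rule words_eq_empty[where N = "n div d"]) (use assms in \<open>simp_all add: size_test_monomial\<close>)
  then show ?thesis by (simp add: necklaces_def)
qed


section \<open>Coefficients of products of power sums\<close>

lemma mcoeff_mconst_mult: "mcoeff (mconst c * F) m = c * mcoeff F m"
proof -
  have "mcoeff (mconst c * F) m = (\<Sum>p\<in>{(a, b). a + b = m}. if p = ({#}, m) then c * mcoeff F m else 0)"
    unfolding times_mfps_def mconst_def mcoeff_Mfps
    by (intro sum.cong refl) (clarsimp split: if_splits)
  then show ?thesis by simp
qed

lemma mcoeff_psum_mult: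
  assumes "k > 0"
  shows "mcoeff (psum k * F) m =
    (\<Sum>x | replicate_mset k x \<subseteq># m. mcoeff F (m - replicate_mset k x))"
proof -
  let ?X = "{x. replicate_mset k x \<subseteq># m}" and ?f = "\<lambda>x. (replicate_mset k x, m - replicate_mset k x)"
  have inj: "inj_on ?f ?X"
    using assms by (auto simp: inj_on_def replicate_mset_eq_iff)
  have img: "?f ` ?X \<subseteq> {(a, b). a + b = m}"
    by auto
  have zero: "mcoeff (psum k) (fst p) * mcoeff F (snd p) = 0" if "p \<in> {(a, b). a + b = m} - ?f ` ?X" for p
    using that by (force simp: psum_def)
  have "mcoeff (psum k * F) m = (\<Sum>p\<in>{(a, b). a + b = m}. mcoeff (psum k) (fst p) * mcoeff F (snd p))"
    by (simp add: times_mfps_def case_prod_unfold)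
  also have "\<dots> = (\<Sum>p\<in>?f ` ?X. mcoeff (psum k) (fst p) * mcoeff F (snd p))"
    using img zero by (intro sum.mono_neutral_right) auto
  also have "\<dots> = (\<Sum>x\<in>?X. mcoeff F (m - replicate_mset k x))"
    unfolding sum.reindex[OF inj] by (intro sum.cong) (auto simp: psum_def)
  finally show ?thesis .
qed

text \<open>
  A monomial of $\prod_i p_{k_i}$ arises by choosing a letter for every \<open>i\<close>.  Finiteness of the
  set of choices is carried through the induction since \<open>card\<close> is 0 on infinite sets.
\<close>
lemma
  fixes k :: "'i \<Rightarrow> nat"
  assumes "finite I" "\<And>i. i \<in> I \<Longrightarrow> k i > 0"
  shows mcoeff_prod_psum: "mcoeff (\<Prod>i\<in>I. psum (k i)) m =
      of_nat (card {g \<in> extensional I. (\<Sum>i\<in>I. replicate_mset (k i) (g i)) = m})"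
proof -
  let ?S = "\<lambda>I m. {g \<in> extensional I. (\<Sum>i\<in>I. replicate_mset (k i) (g i)) = m}"
  have "finite (?S I m) \<and> mcoeff (\<Prod>i\<in>I. psum (k i)) m = of_nat (card (?S I m))"
    using assms
  proof (induction I arbitrary: m)
    case empty
    have "?S {} m = (if m = {#} then {\<lambda>_. undefined} else {})"
      by auto
    then show ?case by (simp add: one_mfps_def)
  next
    case (insert i I)
    let ?X = "{x. replicate_mset (k i) x \<subseteq># m}"
    let ?Sig = "SIGMA x : ?X. ?S I (m - replicate_mset (k i) x)"
    have ki: "k i > 0" using insert.prems by simp
    have "?X \<subseteq> set_mset m"
      using ki by (auto dest!: mset_subset_eqD[where x = "_ :: nat"] simp: subset_eq)
    then have fin: "finite ?X" by (rule finite_subset) simp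
    have IH: "finite (?S I m')" "mcoeff (\<Prod>i\<in>I. psum (k i)) m' = (of_nat (card (?S I m')) :: 'b)" for m'
      using insert.IH[of m'] insert.prems by auto
    have upd: "(\<Sum>j\<in>I. replicate_mset (k j) (if j = i then x else g j)) = (\<Sum>j\<in>I. replicate_mset (k j) (g j))"
      for x g using insert.hyps by (intro sum.cong) auto
    have "bij_betw (\<lambda>(x, g). g(i := x)) ?Sig (?S (insert i I) m)"
      by (rule bij_betw_byWitness[where f' = "\<lambda>f. (f i, restrict f I)"])
        (use insert.hyps in \<open>auto simp: extensional_def upd fun_eq_iff restrict_def
            intro!: subset_mset.add_diff_inverse\<close>)
    note bij = this
    have finS: "finite ?Sig"
      using fin IH by (intro finite_SigmaI) auto
    have "mcoeff (\<Prod>i\<in>insert i I. psum (k i)) m = (\<Sum>x\<in>?X. of_nat (card (?S I (m - replicate_mset (k i) x))) :: 'b)"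
      using insert.hyps ki by (simp add: mcoeff_psum_mult IH)
    also have "\<dots> = of_nat (card ?Sig)"
      using fin IH by (simp add: card_SigmaI)
    also have "card ?Sig = card (?S (insert i I) m)"
      using bij by (rule bij_betw_same_card)
    finally show ?case
      using bij_betw_finite[OF bij] finS by blast
  qed
  then show ?thesis by blast
qed

lemma image_mset_mset_set_eq_sum: "image_mset f (mset_set X) = (\<Sum>x\<in>X. {#f x#})"
  by (induction X rule: infinite_finite_induct) auto

text \<open>
  A factor $p_{|C|}$ chooses the common letter of the positions in \<open>C\<close>.  So the coefficients
  count the words that are constant on the orbits of \<open>w\<close>, that is, fixed by \<open>w\<close>.
\<close>
lemma mcoeff_prod_psum_orbits:
  assumes w: "w permutes X" and X: "finite X"
  shows "mcoeff (\<Prod>C\<in>orbit w ` X. psum (card C)) m =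
    of_nat (card {f \<in> extensional X. (\<forall>x\<in>X. f (w x) = f x) \<and> image_mset f (mset_set X) = m})"
proof -
  let ?O = "orbit w ` X"
  have perm: "permutation w"
    using w X by (auto simp: permutation_permutes)
  have self: "x \<in> orbit w x" for x
    using perm by (rule permutation_self_in_orbit)
  have sub: "orbit w x \<subseteq> X" if "x \<in> X" for x
    using w that by (rule permutes_orbit_subset)
  have eq: "orbit w y = orbit w x" if "y \<in> orbit w x" for x y
    using cyclic_on_orbit'[OF perm] that by (rule orbit_cyclic_eq3)
  have pos: "card C > 0" if "C \<in> ?O" for C
    using that X sub self by (auto simp: card_gt_0_iff dest: finite_subset)
  have content: "(\<Sum>C\<in>?O. replicate_mset (card C) (g C)) = image_mset (\<lambda>x. g (orbit w x)) (mset_set X)"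
    for g :: "'a set \<Rightarrow> nat"
  proof -
    have fib: "{x \<in> X. orbit w x = C} = C" if "C \<in> ?O" for C
      using that sub eq self by blast
    have "image_mset (\<lambda>x. g (orbit w x)) (mset_set X) = (\<Sum>C\<in>?O. \<Sum>x\<in>{x \<in> X. orbit w x = C}. {#g (orbit w x)#})"
      unfolding image_mset_mset_set_eq_sum using X by (intro sum.group[symmetric]) auto
    also have "\<dots> = (\<Sum>C\<in>?O. replicate_mset (card C) (g C))"
    proof (rule sum.cong)
      fix C assume C: "C \<in> ?O"
      have "(\<Sum>x | x \<in> X \<and> orbit w x = C. {#g (orbit w x)#}) = (\<Sum>x | x \<in> X \<and> orbit w x = C. {#g C#})"
        by (intro sum.cong) auto
      then show "(\<Sum>x | x \<in> X \<and> orbit w x = C. {#g (orbit w x)#}) = replicate_mset (card C) (g C)"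
        using fib[OF C] by (simp add: image_mset_const_eq flip: image_mset_mset_set_eq_sum)
    qed simp
    finally show ?thesis ..
  qed
  let ?A = "{g \<in> extensional ?O. (\<Sum>C\<in>?O. replicate_mset (card C) (g C)) = m}"
  let ?B = "{f \<in> extensional X. (\<forall>x\<in>X. f (w x) = f x) \<and> image_mset f (mset_set X) = m}"
  have const: "f y = f x" if f: "\<forall>x\<in>X. f (w x) = f x" and "x \<in> X" "y \<in> orbit w x" for f :: "'a \<Rightarrow> nat" and x y
    using that(3)
  proof induction
    case (step y)
    with f sub[OF \<open>x \<in> X\<close>] show ?case by auto
  qed (use that in auto)
  have wX: "w x \<in> X" if "x \<in> X" for x
    using w that by (simp add: permutes_in_image)
  have worb: "orbit w (w x) = orbit w x" for x
    by (rule eq) (rule orbit.base)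
  have rep: "(SOME y. y \<in> orbit w x) \<in> orbit w x" for x
    using self by (rule someI)
  have "bij_betw (\<lambda>g. restrict (\<lambda>x. g (orbit w x)) X) ?A ?B"
  proof (rule bij_betw_byWitness[where f' = "\<lambda>f. restrict (\<lambda>C. f (SOME x. x \<in> C)) ?O"])
    show "\<forall>g\<in>?A. restrict (\<lambda>C. restrict (\<lambda>x. g (orbit w x)) X (SOME x. x \<in> C)) ?O = g"
    proof (intro ballI ext)
      fix g C assume g: "g \<in> ?A"
      show "restrict (\<lambda>C. restrict (\<lambda>x. g (orbit w x)) X (SOME x. x \<in> C)) ?O C = g C"
      proof (cases "C \<in> ?O")
        case True
        then have "(SOME x. x \<in> C) \<in> C" using rep by auto
        then show ?thesis using True sub eq by (auto simp: subset_iff)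
      qed (use g in \<open>auto simp: extensional_def\<close>)
    qed
    show "\<forall>f\<in>?B. restrict (\<lambda>x. restrict (\<lambda>C. f (SOME x. x \<in> C)) ?O (orbit w x)) X = f"
      using const rep by (auto simp: fun_eq_iff extensional_def restrict_def)
    have cong: "image_mset (restrict f X) (mset_set X) = image_mset f (mset_set X)" for f :: "'a \<Rightarrow> nat"
      by (rule image_mset_cong) (use X in auto)
    show "(\<lambda>g. restrict (\<lambda>x. g (orbit w x)) X) ` ?A \<subseteq> ?B"
      using wX by (auto simp: content worb cong)
    have "image_mset (\<lambda>x. restrict (\<lambda>C. f (SOME x. x \<in> C)) ?O (orbit w x)) (mset_set X) = image_mset f (mset_set X)"
      if "f \<in> ?B" for f
      by (rule image_mset_cong) (use X that const rep in auto)
    then show "(\<lambda>f. restrict (\<lambda>C. f (SOME x. x \<in> C)) ?O) ` ?B \<subseteq> ?A"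
      by (auto simp: content)
  qed
  then have "card ?A = card ?B" by (rule bij_betw_same_card)
  then show ?thesis
    using X pos by (subst mcoeff_prod_psum) auto
qed

lemma bij_betw_map_extensional:
  assumes "distinct l"
  shows "bij_betw (\<lambda>f. map f l) (extensional (set l)) {u :: 'b list. length u = length l}"
  unfolding bij_betw_def
proof
  show "inj_on (\<lambda>f. map f l) (extensional (set l) :: ('a \<Rightarrow> 'b) set)"
    by (auto simp: inj_on_def intro: extensionalityI)
  have "u \<in> (\<lambda>f. map f l) ` extensional (set l)" if "length u = length l" for u :: "'b list"
  proof
    let ?f = "restrict (\<lambda>x. the (map_of (zip l u) x)) (set l)"
    show "u = map ?f l"
      using assms that by (intro nth_equalityI) (auto simp: map_of_zip_nth)
  qed simp
  then show "(\<lambda>f. map f l) ` (extensional (set l) :: ('a \<Rightarrow> 'b) set) = {u. length u = length l}"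
    by auto
qed

text \<open>
  If \<open>w\<close> rotates the list \<open>l\<close> of all positions by \<open>k\<close>, then reading a function along
  \<open>l\<close> turns the functions fixed by \<open>w\<close> into the words fixed by the rotation by \<open>k\<close>.
  The list is arbitrary, which covers all conjugates of a power of the long cycle.
\<close>
lemma mcoeff_cycle_type_power:
  assumes w: "w permutes set l" and l: "distinct l" and rot: "map w l = rotate k l"
  shows "mcoeff (\<Prod>C\<in>orbit w ` set l. psum (card C)) m =
    of_nat (card {u. length u = length l \<and> mset u = m \<and> rotate k u = u})"
proof -
  have "rotate k (map f l) = map f l \<longleftrightarrow> (\<forall>x\<in>set l. f (w x) = f x)" for f :: "'a \<Rightarrow> nat"
    by (simp add: rotate_map flip: rot)
  moreover have "mset (map f l) = image_mset f (mset_set (set l))" for f :: "'a \<Rightarrow> nat"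
    using l by (simp add: mset_set_set)
  ultimately have eq: "(\<forall>x\<in>set l. f (w x) = f x) \<and> image_mset f (mset_set (set l)) = m \<longleftrightarrow>
      mset (map f l) = m \<and> rotate k (map f l) = map f l" for f :: "'a \<Rightarrow> nat"
    by metis
  have "bij_betw (\<lambda>f. map f l)
      {f \<in> extensional (set l). (\<forall>x\<in>set l. f (w x) = f x) \<and> image_mset f (mset_set (set l)) = m}
      {u \<in> {u. length u = length l}. mset u = m \<and> rotate k u = u}"
    by (rule bij_betw_Collect[OF bij_betw_map_extensional[OF l]]) (simp only: eq)
  from bij_betw_same_card[OF this] show ?thesis
    unfolding mcoeff_prod_psum_orbits[OF w finite_set] by simp
qed


section \<open>The character of the induced module\<close>

lemma sum_fun_apply: "(\<Sum>i\<in>I. f i) x = (\<Sum>i\<in>I. f i x :: complex)"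
  by (induction I rule: infinite_finite_induct) auto

text \<open>
  The functions \<open>e g\<close> are the images of the delta functions under a projection onto \<open>W\<close>.
  They need not form a basis of \<open>W\<close>, but the trace of \<open>A\<close> is still read off
  from them: expanding \<open>A b\<close> in the \<open>e g\<close> and these in the basis \<open>B\<close> makes every
  reference to \<open>B\<close> cancel.
\<close>
lemma trace_on_eq_sum:
  fixes W :: "('g \<Rightarrow> complex) set" and e :: "'g \<Rightarrow> 'g \<Rightarrow> complex"
  assumes G: "finite G" and W: "cfun.subspace W"
    and e: "\<And>g. g \<in> G \<Longrightarrow> e g \<in> W"
    and expand: "\<And>f h. f \<in> W \<Longrightarrow> f h = (\<Sum>g\<in>G. f g * e g h)"
    and A: "\<And>f. f \<in> W \<Longrightarrow> A f \<in> W"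
    and add: "\<And>f f'. A (f + f') = A f + A f'"
    and scale: "\<And>c f. A (\<lambda>x. c * f x) = (\<lambda>x. c * A f x)"
  shows "trace_on W A = (\<Sum>g\<in>G. A (e g) g)"
proof -
  define B where "B = (SOME B. cfun.independent B \<and> cfun.span B = W)"
  obtain B' where "B' \<subseteq> W" "cfun.independent B'" "W \<subseteq> cfun.span B'"
    using cfun.maximal_independent_subset[of W] by blast
  then have "cfun.independent B' \<and> cfun.span B' = W"
    using cfun.span_subspace[OF _ _ W] by blast
  then have "cfun.independent B \<and> cfun.span B = W"
    unfolding B_def by (rule someI[of "\<lambda>B. cfun.independent B \<and> cfun.span B = W"])
  then have B: "cfun.independent B" "cfun.span B = W"
    by blast+
  have expand': "f = (\<Sum>g\<in>G. (\<lambda>h. f g * e g h))" if "f \<in> W" for f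
  proof
    show "f h = (\<Sum>g\<in>G. (\<lambda>h. f g * e g h)) h" for h
      unfolding sum_fun_apply by (rule expand[OF that])
  qed
  have "W \<subseteq> cfun.span (e ` G)"
  proof
    fix f assume "f \<in> W"
    have "(\<Sum>g\<in>G. (\<lambda>h. f g * e g h)) \<in> cfun.span (e ` G)"
      by (intro cfun.span_sum cfun.span_scale cfun.span_base) auto
    then show "f \<in> cfun.span (e ` G)"
      by (simp only: expand'[OF \<open>f \<in> W\<close>, symmetric])
  qed
  then have fin: "finite B"
    using cfun.independent_span_bound[of "e ` G" B] G B cfun.span_superset[of B] by auto
  have A_sum: "A (\<Sum>i\<in>I. (\<lambda>x. c i * f i x)) = (\<Sum>i\<in>I. (\<lambda>x. c i * A (f i) x))"
    if "finite I" for I :: "('g \<Rightarrow> complex) set" and c f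
    using that
  proof induction
    case empty
    have "A (\<lambda>x. 0 * 0) = (\<lambda>x. 0 * A (\<lambda>_. 0) x)" by (rule scale)
    then show ?case by (simp add: zero_fun_def)
  next
    case (insert i I)
    have "(\<Sum>i\<in>insert i I. (\<lambda>x. c i * f i x)) = (\<lambda>x. c i * f i x) + (\<Sum>i\<in>I. (\<lambda>x. c i * f i x))"
      using insert.hyps by (rule sum.insert)
    moreover have "(\<Sum>i\<in>insert i I. (\<lambda>x. c i * A (f i) x)) =
        (\<lambda>x. c i * A (f i) x) + (\<Sum>i\<in>I. (\<lambda>x. c i * A (f i) x))"
      using insert.hyps by (rule sum.insert)
    ultimately show ?case by (simp only: add scale insert.IH)
  qed
  have BW: "b \<in> W" if "b \<in> B" for b
    using that B cfun.span_superset by blast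
  have rep: "cfun.representation B (A b) b = (\<Sum>g\<in>G. A b g * cfun.representation B (e g) b)" if "b \<in> B" for b
  proof -
    have "cfun.representation B (A b) = cfun.representation B (\<Sum>g\<in>G. (\<lambda>h. A b g * e g h))"
      by (simp only: expand'[OF A[OF BW[OF that]], symmetric])
    also have "\<dots> = (\<lambda>v. \<Sum>g\<in>G. cfun.representation B (\<lambda>h. A b g * e g h) v)"
      using B e W by (intro cfun.representation_sum) (auto intro: cfun.subspace_scale)
    also have "\<dots> = (\<lambda>v. \<Sum>g\<in>G. A b g * cfun.representation B (e g) v)"
      using B e by (intro ext sum.cong) (auto simp: cfun.representation_scale)
    finally show ?thesis by simp
  qed
  have "trace_on W A = (\<Sum>b\<in>B. \<Sum>g\<in>G. A b g * cfun.representation B (e g) b)"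
    using rep by (simp add: trace_on_def Let_def flip: B_def)
  also have "\<dots> = (\<Sum>g\<in>G. \<Sum>b\<in>B. cfun.representation B (e g) b * A b g)"
    by (subst sum.swap) (simp add: mult.commute)
  also have "\<dots> = (\<Sum>g\<in>G. A (\<Sum>b\<in>B. (\<lambda>h. cfun.representation B (e g) b * b h)) g)"
    by (simp add: A_sum[OF fin] sum_fun_apply)
  also have "\<dots> = (\<Sum>g\<in>G. A (e g) g)"
    using B e fin by (intro sum.cong refl) (simp add: cfun.sum_representation_eq)
  finally show ?thesis .
qed

lemma sum_shift_periodic:
  fixes f :: "nat \<Rightarrow> 'a::comm_monoid_add"
  assumes "\<And>k. f (k + n) = f k"
  shows "(\<Sum>k<n. f (k + j)) = (\<Sum>k<n. f k)"
proof (induction j)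
  case (Suc j)
  have "(\<Sum>k<n. f (k + Suc j)) = (\<Sum>k<n. f (k + j))"
  proof (cases n)
    case (Suc l)
    have "f (Suc l + j) = f j"
      using assms[of j] Suc by (simp add: add.commute)
    then have "(\<Sum>k<Suc l. f (Suc k + j)) = (\<Sum>k<l. f (Suc k + j)) + f j"
      by simp
    also have "\<dots> = (\<Sum>k<Suc l. f (k + j))"
      by (subst sum.lessThan_Suc_shift) (simp add: add.commute)
    finally show ?thesis using Suc by simp
  qed simp
  then show ?case using Suc by simp
qed simp

lemma
  shows long_cycle_permutes: "long_cycle n permutes {1..n}"
    and map_long_cycle_power: "map (long_cycle n ^^ k) [1..<n + 1] = rotate k [1..<n + 1]"
    and long_cycle_power_n: "long_cycle n ^^ n = id"
proof -
  have "set [1..<n + 1] = {1..n}" by auto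
  then show "long_cycle n permutes {1..n}"
    using cycle_permutes[of "[1..<n + 1]"] by (simp only: long_cycle_def)
  show "map (long_cycle n ^^ k) [1..<n + 1] = rotate k [1..<n + 1]"
    unfolding long_cycle_def by (rule cyclic_rotation) simp
  show "long_cycle n ^^ n = id"
    using cycle_is_id_root[OF distinct_upt, of 1 "n + 1"]
    unfolding long_cycle_def by (simp del: upt_Suc)
qed

lemma permutes_funpow: "p permutes S \<Longrightarrow> (p ^^ k) permutes S"
  by (induction k) (auto simp: permutes_id intro: permutes_compose simp flip: id_def)

lemma permutes_comp_right_iff:
  assumes "c permutes S"
  shows "(h \<circ> c) permutes S \<longleftrightarrow> h permutes S"
proof
  assume "(h \<circ> c) permutes S"
  then have "(h \<circ> c) \<circ> inv c permutes S"
    by (rule permutes_compose[OF permutes_inv[OF assms]])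
  then show "h permutes S"
    using assms by (simp add: comp_assoc permutes_inv_o)
qed (use assms in \<open>auto intro: permutes_compose\<close>)

lemma permutes_comp_left_iff:
  assumes "c permutes S"
  shows "(c \<circ> h) permutes S \<longleftrightarrow> h permutes S"
proof
  assume "(c \<circ> h) permutes S"
  then have "inv c \<circ> (c \<circ> h) permutes S"
    by (rule permutes_compose[OF _ permutes_inv[OF assms]])
  then show "h permutes S"
    using assms by (simp add: permutes_inv_o flip: comp_assoc)
qed (use assms in \<open>auto intro: permutes_compose\<close>)

definition cyclic_weight :: "nat \<Rightarrow> int \<Rightarrow> nat \<Rightarrow> complex" where
  "cyclic_weight n r k = cis (2 * pi * of_int r * of_nat k / of_nat n)"

lemma cyclic_weight_add: "cyclic_weight n r (j + k) = cyclic_weight n r j * cyclic_weight n r k"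
  by (simp add: cyclic_weight_def cis_mult add_divide_distrib algebra_simps)

lemma cyclic_weight_nonzero: "cyclic_weight n r k \<noteq> 0"
  by (simp add: cyclic_weight_def)

lemma cyclic_weight_n: "n > 0 \<Longrightarrow> cyclic_weight n r n = 1"
  by (simp add: cyclic_weight_def)

text \<open>
  The projection onto the induced module averages over $C_n$ with the weights $\chi(c^k)$, so
  $e_g(h) = \frac 1n \sum_k \chi(c^k) [h c^k = g]$.  Its value at $h = w^{-1} g$ averages the
  weights of the $k$ with $w g = g c^k$; summed over $g$ this is the usual formula for an induced character.
\<close>
lemma induced_character_eq:
  assumes n: "n \<ge> 1" and w: "w permutes {1..n}"
  shows "induced_character n r w =
    (\<Sum>g | g permutes {1..n}. (\<Sum>k<n. cyclic_weight n r k * of_bool (w \<circ> g = g \<circ> long_cycle n ^^ k)) / of_nat n)"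
proof -
  let ?G = "{g. g permutes {1..n}}" and ?c = "long_cycle n" and ?\<chi> = "cyclic_weight n r"
  define e :: "(nat \<Rightarrow> nat) \<Rightarrow> (nat \<Rightarrow> nat) \<Rightarrow> complex" where
    "e g h = (\<Sum>k<n. ?\<chi> k * of_bool (h \<circ> ?c ^^ k = g)) / of_nat n" for g h
  have c: "(?c ^^ k) permutes {1..n}" for k
    by (intro permutes_funpow long_cycle_permutes)
  have mem_iff: "f \<in> induced_module n r \<longleftrightarrow> (\<forall>g. \<not> g permutes {1..n} \<longrightarrow> f g = 0) \<and>
      (\<forall>g k. g permutes {1..n} \<longrightarrow> f (g \<circ> ?c ^^ k) = inverse (?\<chi> k) * f g)" for f
    by (simp add: induced_module_def cyclic_weight_def)
  have "trace_on (induced_module n r) (perm_action w) = (\<Sum>g\<in>?G. perm_action w (e g) g)"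
  proof (rule trace_on_eq_sum)
    show "finite ?G" by (simp add: finite_permutations)
    show "cfun.subspace (induced_module n r)"
      by (auto simp: cfun.subspace_def mem_iff algebra_simps)
    show "e g \<in> induced_module n r" if g: "g \<in> ?G" for g
      unfolding mem_iff
    proof (intro conjI allI impI)
      fix h :: "nat \<Rightarrow> nat" assume "\<not> h permutes {1..n}"
      then have "h \<circ> ?c ^^ k \<noteq> g" for k
        using g permutes_comp_right_iff[OF c, of h k] by auto
      then show "e g h = 0" by (simp add: e_def)
    next
      fix h :: "nat \<Rightarrow> nat" and j
      let ?f = "\<lambda>k. ?\<chi> k * of_bool (h \<circ> ?c ^^ k = g)"
      have "?\<chi> j * (\<Sum>k<n. ?\<chi> k * of_bool ((h \<circ> ?c ^^ j) \<circ> ?c ^^ k = g)) = (\<Sum>k<n. ?f (k + j))"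
        unfolding sum_distrib_left
        by (intro sum.cong refl) (simp add: cyclic_weight_add comp_assoc funpow_add
            add.commute[of _ j])
      also have "\<dots> = (\<Sum>k<n. ?f k)"
        using n by (intro sum_shift_periodic)
          (simp add: cyclic_weight_add cyclic_weight_n funpow_add long_cycle_power_n)
      finally have eq: "?\<chi> j * (\<Sum>k<n. ?\<chi> k * of_bool ((h \<circ> ?c ^^ j) \<circ> ?c ^^ k = g)) = (\<Sum>k<n. ?f k)" .
      have cancel: "y = inverse x * z" if "x * y = z" "x \<noteq> 0" for x y z :: complex
        using that by (auto simp: field_simps)
      have "(\<Sum>k<n. ?\<chi> k * of_bool ((h \<circ> ?c ^^ j) \<circ> ?c ^^ k = g)) = inverse (?\<chi> j) * (\<Sum>k<n. ?f k)"
        by (rule cancel[OF eq cyclic_weight_nonzero])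
      then show "e g (h \<circ> ?c ^^ j) = inverse (?\<chi> j) * e g h"
        unfolding e_def by (simp only: times_divide_eq_right)
    qed
    show "f h = (\<Sum>g\<in>?G. f g * e g h)" if f: "f \<in> induced_module n r" for f h
    proof (cases "h permutes {1..n}")
      case True
      \<comment> \<open>With an opaque \<open>b\<close> instead of \<open>of_bool\<close>, the simplifier does not turn the
        sums into sums over intersections.\<close>
      have dist: "(\<Sum>g\<in>?G. f g * ((\<Sum>k<n. ?\<chi> k * b g k) / of_nat n)) =
          (\<Sum>g\<in>?G. \<Sum>k<n. ?\<chi> k * (f g * b g k)) / of_nat n" for b
        by (simp add: sum_divide_distrib sum_distrib_left mult_ac)
      have "(\<Sum>g\<in>?G. f g * e g h) =
          (\<Sum>g\<in>?G. \<Sum>k<n. ?\<chi> k * (f g * of_bool (h \<circ> ?c ^^ k = g))) / of_nat n"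
        unfolding e_def by (rule dist)
      also have "(\<Sum>g\<in>?G. \<Sum>k<n. ?\<chi> k * (f g * of_bool (h \<circ> ?c ^^ k = g))) =
          (\<Sum>k<n. \<Sum>g\<in>?G. ?\<chi> k * (f g * of_bool (h \<circ> ?c ^^ k = g)))"
        by (rule sum.swap)
      also have "\<dots> = (\<Sum>k<n. f h)"
      proof (rule sum.cong)
        fix k
        have "(\<Sum>g\<in>?G. ?\<chi> k * (f g * of_bool (h \<circ> ?c ^^ k = g))) =
            (\<Sum>g\<in>?G. if g = h \<circ> ?c ^^ k then ?\<chi> k * f g else 0)"
          by (intro sum.cong) auto
        also have "\<dots> = ?\<chi> k * f (h \<circ> ?c ^^ k)"
          using True c by (simp add: finite_permutations permutes_comp_right_iff)
        also have "\<dots> = f h"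
          using f True cyclic_weight_nonzero[of n r k] by (simp add: mem_iff)
        finally show "(\<Sum>g\<in>?G. ?\<chi> k * (f g * of_bool (h \<circ> ?c ^^ k = g))) = f h" .
      qed simp
      finally show ?thesis using n by simp
    next
      case False
      then have "h \<circ> ?c ^^ k \<noteq> g" if "g \<in> ?G" for g k
        using that permutes_comp_right_iff[OF c, of h k] by auto
      then have "e g h = 0" if "g \<in> ?G" for g
        using that by (simp add: e_def)
      with False f show ?thesis by (simp add: mem_iff)
    qed
    show "perm_action w f \<in> induced_module n r" if "f \<in> induced_module n r" for f
      using that permutes_comp_left_iff[OF permutes_inv[OF w]]
      by (simp add: mem_iff perm_action_def flip: comp_assoc)
  qed (simp_all add: perm_action_def plus_fun_def)
  also have "\<dots> = (\<Sum>g\<in>?G. (\<Sum>k<n. ?\<chi> k * of_bool (w \<circ> g = g \<circ> ?c ^^ k)) / of_nat n)"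
  proof (intro sum.cong refl)
    fix g assume "g \<in> ?G"
    have "inv w \<circ> g \<circ> ?c ^^ k = g \<longleftrightarrow> w \<circ> g = g \<circ> ?c ^^ k" for k
      using permutes_inv_o[OF w] by (metis comp_assoc id_comp)
    then show "perm_action w (e g) g = (\<Sum>k<n. ?\<chi> k * of_bool (w \<circ> g = g \<circ> ?c ^^ k)) / of_nat n"
      by (simp add: perm_action_def e_def)
  qed
  finally show ?thesis by (simp add: induced_character_def)
qed

text \<open>
  For given \<open>g\<close> and \<open>k\<close> only $w = g c^k g^{-1}$ contributes, and its cycle type does not
  depend on \<open>g\<close>.  Hence the sum over \<open>g\<close> cancels the factor $1/n!$.
\<close>
lemma mcoeff_foulkes_sum:
  assumes n: "n \<ge> 1"
  shows "mcoeff (foulkes n r) m = (\<Sum>k<n. cyclic_weight n r k *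
    of_nat (card {u. length u = n \<and> mset u = m \<and> rotate k u = u})) / of_nat n"
proof -
  let ?G = "{g. g permutes {1..n}}" and ?c = "long_cycle n" and ?\<chi> = "cyclic_weight n r"
  let ?p = "\<lambda>w. mcoeff (\<Prod>C\<in>orbit w ` {1..n}. psum (card C)) m :: complex"
  let ?fix = "\<lambda>k. of_nat (card {u. length u = n \<and> mset u = m \<and> rotate k u = u}) :: complex"
  have finG: "finite ?G" by (simp add: finite_permutations)
  have conj: "(\<Sum>w\<in>?G. of_bool (w \<circ> g = g \<circ> ?c ^^ k) * ?p w) = ?fix k" if g: "g \<in> ?G" for g k
  proof -
    let ?w = "g \<circ> ?c ^^ k \<circ> inv g" and ?l = "map g [1..<n + 1]"
    have g': "g permutes {1..n}" using g by simp
    have w: "?w permutes {1..n}"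
      using g' by (intro permutes_compose permutes_inv permutes_funpow long_cycle_permutes)
    have iff: "w \<circ> g = g \<circ> ?c ^^ k \<longleftrightarrow> w = ?w" for w
      using permutes_inv_o[OF g'] by (metis comp_assoc comp_id)
    have set_l: "set ?l = {1..n}"
      using permutes_image[OF g'] by (simp add: atLeastLessThanSuc_atLeastAtMost del: upt_Suc)
    have "distinct ?l"
      using permutes_inj[OF g'] by (simp add: distinct_map inj_on_def del: upt_Suc)
    moreover have "map ?w ?l = rotate k ?l"
    proof -
      have "?w \<circ> g = g \<circ> ?c ^^ k"
        using permutes_inv_o[OF g'] by (simp add: comp_assoc)
      then have "map ?w ?l = map g (map (?c ^^ k) [1..<n + 1])"
        by (simp only: map_map)
      then show ?thesis by (simp only: map_long_cycle_power rotate_map)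
    qed
    ultimately have "?p ?w = ?fix k"
      using mcoeff_cycle_type_power[of ?w ?l k m] w unfolding set_l by (simp del: upt_Suc)
    moreover have "(\<Sum>w\<in>?G. of_bool (w \<circ> g = g \<circ> ?c ^^ k) * ?p w) = (\<Sum>w\<in>?G. if w = ?w then ?p w else 0)"
      unfolding iff by (intro sum.cong) auto
    ultimately show ?thesis using w finG by simp
  qed
  have dist: "(\<Sum>g\<in>?G. (\<Sum>k<n. ?\<chi> k * b g k) / of_nat n) / fact n * q =
      (\<Sum>g\<in>?G. \<Sum>k<n. ?\<chi> k * (b g k * q)) / (fact n * of_nat n)"
    for b :: "(nat \<Rightarrow> nat) \<Rightarrow> nat \<Rightarrow> complex" and q
    by (simp add: sum_divide_distrib sum_distrib_left sum_distrib_right mult_ac)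
  have "mcoeff (foulkes n r) m = (\<Sum>w\<in>?G. induced_character n r w / fact n * ?p w)"
    by (simp add: foulkes_def frobenius_char_def mcoeff_mconst_mult)
  also have "\<dots> = (\<Sum>w\<in>?G. \<Sum>g\<in>?G. \<Sum>k<n. ?\<chi> k * (of_bool (w \<circ> g = g \<circ> ?c ^^ k) * ?p w)) / (fact n * of_nat n)"
    by (subst sum_divide_distrib, intro sum.cong refl)
      (simp only: mem_Collect_eq induced_character_eq[OF n] dist)
  also have "(\<Sum>w\<in>?G. \<Sum>g\<in>?G. \<Sum>k<n. ?\<chi> k * (of_bool (w \<circ> g = g \<circ> ?c ^^ k) * ?p w)) =
      (\<Sum>g\<in>?G. \<Sum>k<n. \<Sum>w\<in>?G. ?\<chi> k * (of_bool (w \<circ> g = g \<circ> ?c ^^ k) * ?p w))"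
    by (subst sum.swap) (intro sum.cong refl sum.swap)
  also have "\<dots> = (\<Sum>g\<in>?G. \<Sum>k<n. ?\<chi> k * ?fix k)"
    by (intro sum.cong refl) (simp only: conj flip: sum_distrib_left)
  also have "\<dots> = fact n * (\<Sum>k<n. ?\<chi> k * ?fix k)"
    by (simp add: card_permutations)
  finally show ?thesis by simp
qed


section \<open>Foulkes characteristics and their plethysms as necklace counts\<close>

text \<open>The sum runs over the powers of $e^{2 \pi i r/d}$, a root of unity that is 1 iff $d \mid r$.\<close>
lemma sum_cyclic_weight_multiples:
  assumes n: "n \<ge> 1" and d: "d dvd n"
  shows "(\<Sum>k | k < n \<and> n div d dvd k. cyclic_weight n r k) = (if int d dvd r then of_nat d else 0)"
proof -
  obtain t where nt: "n = d * t" using d by auto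
  have pos: "d > 0" "t > 0" using n nt by (auto intro: Nat.gr0I)
  define z where "z = cis (2 * pi * of_int r / of_nat d)"
  have weight: "cyclic_weight n r (t * j) = z ^ j" for j
    using pos by (simp add: cyclic_weight_def z_def nt Complex.DeMoivre mult_ac)
  have "{k. k < n \<and> n div d dvd k} = (\<lambda>j. t * j) ` {..<d}"
    using pos by (auto simp: nt mult.commute[of d])
  moreover have "inj_on (\<lambda>j. t * j) {..<d}"
    using pos by (auto simp: inj_on_def)
  ultimately have eq: "(\<Sum>k | k < n \<and> n div d dvd k. cyclic_weight n r k) = (\<Sum>j<d. z ^ j)"
    by (simp add: sum.reindex weight)
  have z_iff: "z = 1 \<longleftrightarrow> int d dvd r"
  proof
    assume "z = 1"
    then have "cos (2 * pi * of_int r / of_nat d) = 1"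
      by (simp add: z_def complex_eq_iff)
    then obtain q :: int where "2 * pi * of_int r / of_nat d = of_int q * 2 * pi"
      using cos_one_2pi_int by blast
    then have "real_of_int r = real_of_int (int d * q)"
      using pos by (simp add: field_simps)
    then have "r = int d * q" by linarith
    then show "int d dvd r" by simp
  next
    assume "int d dvd r"
    then obtain q where "r = int d * q" by auto
    then have "2 * pi * of_int r / of_nat d = 2 * pi * of_int q"
      using pos by simp
    then show "z = 1"
      by (simp only: z_def complex_eq_iff cis.sel cos_int_2pin sin_int_2pin one_complex.sel)
  qed
  have "z ^ d = 1"
    using pos by (simp add: z_def Complex.DeMoivre)
  then show ?thesis
    unfolding eq using z_iff by (auto simp: geometric_sum)
qed

text \<open>
  Exchange the sums over rotations and periods: the words of period $n/d$ enter with
  the number $(n/d) N_{n/d}$ of such words times a sum of roots of unity, which is $d$ or 0.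
\<close>
lemma mcoeff_foulkes:
  assumes n: "n \<ge> 1"
  shows "mcoeff (foulkes n r) m =
    (if size m = n then \<Sum>d | d dvd n \<and> int d dvd r. of_nat (necklaces (n div d) m) else 0)"
proof (cases "size m = n")
  case True
  let ?D = "{d. d dvd n}" and ?\<chi> = "cyclic_weight n r"
  let ?c = "\<lambda>d. of_nat ((n div d) * necklaces (n div d) m) :: complex"
  have finD: "finite ?D" using n by simp
  have "(\<Sum>k<n. ?\<chi> k * of_nat (card {u. length u = n \<and> mset u = m \<and> rotate k u = u})) =
      (\<Sum>k<n. \<Sum>d\<in>?D. if n div d dvd k then ?c d * ?\<chi> k else 0)"
  proof (intro sum.cong refl)
    fix k
    have "(\<Sum>d | d dvd n \<and> n div d dvd k. ?c d * ?\<chi> k) = (\<Sum>d\<in>?D. if n div d dvd k then ?c d * ?\<chi> k else 0)"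
      using sum.inter_filter[OF finD, of "\<lambda>d. ?c d * ?\<chi> k" "\<lambda>d. n div d dvd k"] by simp
    then show "?\<chi> k * of_nat (card {u. length u = n \<and> mset u = m \<and> rotate k u = u}) =
        (\<Sum>d\<in>?D. if n div d dvd k then ?c d * ?\<chi> k else 0)"
      unfolding card_words_fixed_by_rotation[OF n True]
      by (simp add: sum_distrib_left mult.commute[of "?\<chi> k"] sum_distrib_right)
  qed
  also have "\<dots> = (\<Sum>d\<in>?D. \<Sum>k<n. if n div d dvd k then ?c d * ?\<chi> k else 0)"
    by (rule sum.swap)
  also have "\<dots> = (\<Sum>d\<in>?D. if int d dvd r then of_nat n * of_nat (necklaces (n div d) m) else 0)"
  proof (intro sum.cong refl)
    fix d assume d: "d \<in> ?D"
    have "(\<Sum>k<n. if n div d dvd k then ?c d * ?\<chi> k else 0) = (\<Sum>k | k < n \<and> n div d dvd k. ?c d * ?\<chi> k)"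
      using sum.inter_filter[of "{..<n}" "\<lambda>k. ?c d * ?\<chi> k" "\<lambda>k. n div d dvd k"] by simp
    also have "\<dots> = ?c d * (\<Sum>k | k < n \<and> n div d dvd k. ?\<chi> k)"
      by (rule sum_distrib_left[symmetric])
    also have "\<dots> = (if int d dvd r then of_nat n * of_nat (necklaces (n div d) m) else 0)"
      using sum_cyclic_weight_multiples[OF n, of d r] d
      by (auto simp flip: of_nat_mult)
    finally show "(\<Sum>k<n. if n div d dvd k then ?c d * ?\<chi> k else 0) =
        (if int d dvd r then of_nat n * of_nat (necklaces (n div d) m) else 0)" .
  qed
  also have "\<dots> = (\<Sum>d | d dvd n \<and> int d dvd r. of_nat n * of_nat (necklaces (n div d) m))"
    using sum.inter_filter[OF finD, of "\<lambda>d. of_nat n * of_nat (necklaces (n div d) m) :: complex" "\<lambda>d. int d dvd r"]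
    by simp
  also have "\<dots> = of_nat n * (\<Sum>d | d dvd n \<and> int d dvd r. of_nat (necklaces (n div d) m))"
    by (rule sum_distrib_left[symmetric])
  finally show ?thesis
    using True n by (simp add: mcoeff_foulkes_sum)
next
  case False
  then show ?thesis
    using n by (simp add: mcoeff_foulkes_sum no_words_of_wrong_length)
qed

text \<open>
  The plethysm by $p_d$ lives on \<open>d\<close>-th powers of monomials, and the words of period $n/d$ are the
  \<open>d\<close>-fold repetitions of the primitive words of length $n/d$, which $\ell_{n/d}^{(1)}$ counts up
  to rotation.
\<close>
lemma mcoeff_Qfun:
  assumes n: "n \<ge> 1" and d: "d dvd n"
  shows "mcoeff (Qfun n d) m = (if size m = n then of_nat (necklaces (n div d) m) else 0)"
proof -
  obtain t where nt: "n = d * t" using d by auto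
  have pos: "d > 0" "t > 0" using n nt by (auto intro: Nat.gr0I)
  have div: "n div d = t" using nt pos by simp
  show ?thesis
  proof (cases "\<exists>m'. m = repeat_mset d m'")
    case True
    then obtain m' where m: "m = repeat_mset d m'" by blast
    have "{e. e dvd t \<and> int e dvd 1} = {1}"
      by auto
    then have "mcoeff (Qfun n d) m = (if size m' = t then of_nat (necklaces t m') else 0)"
      using pos by (simp add: Qfun_def m div mcoeff_pleth_psum_repeat mcoeff_foulkes)
    moreover have "size m = n \<longleftrightarrow> size m' = t"
      using pos by (simp add: m nt)
    moreover have "necklaces t m = necklaces t m'" if "size m' = t"
      using that pos by (simp add: necklaces_def m card_words_repeat)
    ultimately show ?thesis by (simp add: div)
  next
    case False
    then have "necklaces t m = 0" if "size m = n"
      using words_eq_empty[of m d t t] that by (simp add: necklaces_def nt)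
    with False show ?thesis
      by (simp add: Qfun_def mcoeff_pleth_psum_other div)
  qed
qed

lemma foulkes_eq_sum_Qfun:
  assumes n: "n \<ge> 1" and e: "e dvd n"
  shows "foulkes n (int e) = (\<Sum>d | d dvd e. Qfun n d)"
proof (rule mfps_eqI)
  fix m
  have "{d. d dvd n \<and> int d dvd int e} = {d. d dvd e}"
    using e by (auto intro: dvd_trans)
  then show "mcoeff (foulkes n (int e)) m = mcoeff (\<Sum>d | d dvd e. Qfun n d) m"
    using n e by (auto simp: mcoeff_foulkes intro!: sum.cong sum.neutral)
      (auto simp: mcoeff_Qfun dvd_trans)
qed

text \<open>
  $p_d^{n/d}$ enumerates words of length $n/d$ in which every letter counts \<open>d\<close> times; as
  \<open>d\<close>-fold repetitions, these are the words of length \<open>n\<close> fixed by the rotation by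
  $n/d$.
\<close>
lemma mcoeff_psum_power:
  assumes n: "n \<ge> 1" and d: "d dvd n"
  shows "mcoeff (psum d ^ (n div d)) m =
    of_nat (card {w. length w = n \<and> mset w = m \<and> rotate (n div d) w = w})"
proof -
  obtain t where nt: "n = d * t" using d by auto
  have pos: "d > 0" "t > 0" using n nt by (auto intro: Nat.gr0I)
  have div: "n div d = t" using nt pos by simp
  let ?A = "{g \<in> extensional (set [0..<t]). (\<Sum>i<t. replicate_mset d (g i)) = m}"
  let ?B = "{u \<in> {u. length u = length [0..<t]}. mset (repeat_word d u) = m}"
  let ?C = "{w. length w = n \<and> mset w = m \<and> rotate t w = w}"
  have content: "(\<Sum>i<t. replicate_mset d (g i)) = mset (repeat_word d (map g [0..<t]))" for g :: "nat \<Rightarrow> nat"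
    by (induction t) auto
  have "bij_betw (\<lambda>g. map g [0..<t]) ?A ?B"
    by (rule bij_betw_Collect[OF bij_betw_map_extensional]) (simp_all only: content distinct_upt)
  moreover have "bij_betw (repeat_word d) ?B ?C"
    unfolding bij_betw_def
  proof
    show "inj_on (repeat_word d) ?B"
      using pos by (simp add: inj_on_def repeat_word_inject)
    show "repeat_word d ` ?B = ?C"
    proof (intro equalityI subsetI)
      fix w assume "w \<in> ?C"
      then have w: "length w = n" "mset w = m" "rotate t w = w" by auto
      have "repeat_word d (take t w) = w"
        using w nt by (intro repeat_word_take) auto
      moreover have "length (take t w) = t"
        using w nt pos by simp
      ultimately show "w \<in> repeat_word d ` ?B"
        using w(2) by (intro image_eqI[of _ _ "take t w"]) (simp_all del: mset_repeat_word)
    qed (use pos in \<open>auto simp: nt rotate_eq_self_iff period_repeat_word period_dvd_length\<close>)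
  qed
  ultimately have "card ?A = card ?C"
    by (simp only: bij_betw_same_card)
  moreover have "mcoeff (psum d ^ t) m = of_nat (card ?A)"
    using mcoeff_prod_psum[of "{..<t}" "\<lambda>_. d" m] pos by (simp add: atLeast0LessThan)
  ultimately show ?thesis by (simp add: div)
qed

lemma psum_power_eq_sum_Qfun:
  assumes n: "n \<ge> 1" and d: "d dvd n"
  shows "psum d ^ (n div d) = (\<Sum>e | e dvd n \<and> d dvd e. real (n div e) *\<^sub>R Qfun n e)"
proof (rule mfps_eqI)
  fix m
  have "n div e dvd n div d \<longleftrightarrow> d dvd e" if "e dvd n" for e
  proof -
    obtain k where k: "n = d * k"
      using d by (rule dvdE)
    obtain l where l: "n = e * l"
      using \<open>e dvd n\<close> by (rule dvdE)
    note kl = k l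
    have pos: "d > 0" "e > 0" "k > 0" "l > 0"
      using n kl by (auto intro: Nat.gr0I)
    have "l dvd k \<longleftrightarrow> d * l dvd d * k"
      using pos by simp
    also have "\<dots> \<longleftrightarrow> d dvd e"
      using pos by (simp flip: kl(1) add: kl(2))
    finally show ?thesis
      using pos kl by (metis nonzero_mult_div_cancel_left not_gr_zero)
  qed
  then have "{e. e dvd n \<and> n div e dvd n div d} = {e. e dvd n \<and> d dvd e}"
    by blast
  note sets = this
  show "mcoeff (psum d ^ (n div d)) m =
      mcoeff (\<Sum>e | e dvd n \<and> d dvd e. real (n div e) *\<^sub>R Qfun n e) m"
  proof (cases "size m = n")
    case True
    have "mcoeff (psum d ^ (n div d)) m =
        (\<Sum>e | e dvd n \<and> d dvd e. complex_of_nat (n div e * necklaces (n div e) m))"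
      unfolding mcoeff_psum_power[OF n d] card_words_fixed_by_rotation[OF n True] sets by simp
    also have "\<dots> = (\<Sum>e | e dvd n \<and> d dvd e. mcoeff (real (n div e) *\<^sub>R Qfun n e) m)"
      using True n by (intro sum.cong) (auto simp: mcoeff_Qfun scaleR_conv_of_real)
    finally show ?thesis by simp
  next
    case False
    then have "mcoeff (Qfun n e) m = 0" if "e dvd n" for e
      using that n by (simp add: mcoeff_Qfun)
    with False show ?thesis
      unfolding mcoeff_psum_power[OF n d] no_words_of_wrong_length[OF False] by simp
  qed
qed


section \<open>Symmetry of Schur functions\<close>

lemma nat_eqI_below: "(\<And>j. j < m \<longleftrightarrow> j < n) \<Longrightarrow> m = (n :: nat)"
  by (meson less_irrefl linorder_neqE_nat)

lemma nat_eqI_above: "(\<And>x. m < x \<longleftrightarrow> n < x) \<Longrightarrow> m = (n :: nat)"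
  by (meson less_irrefl linorder_neqE_nat)

lemma finite_young_diagram [simp]: "finite (young_diagram mu)"
proof (rule finite_subset)
  show "young_diagram mu \<subseteq> (SIGMA i : {..<length mu}. {..<mu ! i})"
    by (auto simp: young_diagram_def)
qed auto

lemma card_young_diagram_filter:
  "card {c \<in> young_diagram mu. P c} = (\<Sum>i<length mu. card {j. (i, j) \<in> young_diagram mu \<and> P (i, j)})"
proof -
  have "{c \<in> young_diagram mu. P c} =
      (SIGMA i : {..<length mu}. {j. (i, j) \<in> young_diagram mu \<and> P (i, j)})"
    by (auto simp: young_diagram_def)
  moreover have "finite {j. (i, j) \<in> young_diagram mu \<and> P (i, j)}" for i
    by (rule finite_subset[of _ "{..<mu ! i}"]) (auto simp: young_diagram_def)
  ultimately show ?thesis by simp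
qed

lemma young_diagram_left: "(i, j') \<in> young_diagram mu \<Longrightarrow> j \<le> j' \<Longrightarrow> (i, j) \<in> young_diagram mu"
  by (auto simp: young_diagram_def)

lemma young_diagram_up:
  assumes mu: "sorted_wrt (\<ge>) mu" and c: "(i', j) \<in> young_diagram mu" and "i \<le> i'"
  shows "(i, j) \<in> young_diagram mu"
proof (cases "i = i'")
  case False
  then have "mu ! i' \<le> mu ! i"
    using c \<open>i \<le> i'\<close> sorted_wrt_nth_less[OF mu, of i i'] by (simp add: young_diagram_def)
  with c \<open>i \<le> i'\<close> show ?thesis by (simp add: young_diagram_def)
qed (use c in simp)

lemma tableau_row_mono:
  assumes T: "T \<in> semistandard_tableaux mu" and c: "(i, j') \<in> young_diagram mu" and "j \<le> j'"
  shows "T (i, j) \<le> T (i, j')"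
  using \<open>j \<le> j'\<close> c
proof (induction j' rule: dec_induct)
  case (step k)
  then have "T (i, k) \<le> T (i, Suc k)"
    using T by (auto simp: semistandard_tableaux_def)
  with step show ?case using young_diagram_left[of i "Suc k" mu k] by simp
qed simp

lemma initial_segment_eq_lessThan_card:
  fixes S :: "nat set"
  assumes fin: "finite S" and down: "\<And>x y. x \<in> S \<Longrightarrow> y \<le> x \<Longrightarrow> y \<in> S"
  shows "S = {..<card S}"
proof -
  define L where "L = (LEAST x. x \<notin> S)"
  have "\<exists>x. x \<notin> S"
    using fin ex_new_if_finite infinite_UNIV_nat by blast
  then have L: "L \<notin> S"
    unfolding L_def by (rule LeastI_ex)
  have "x \<in> S" if "x < L" for x
    using not_less_Least[of x "\<lambda>x. x \<notin> S"] that by (auto simp: L_def)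
  moreover have "x < L" if "x \<in> S" for x
    using down[OF that, of L] L by (meson not_le)
  ultimately have "S = {..<L}" by auto
  then show ?thesis by (metis card_lessThan)
qed

text \<open>
  The rows of the tableau formed by the entries less than \<open>x\<close>.  For consecutive \<open>x\<close> these
  shapes interlace, and a tableau is the same as such a chain of shapes.
\<close>
definition row_below :: "nat list \<Rightarrow> (nat \<times> nat \<Rightarrow> nat) \<Rightarrow> nat \<Rightarrow> nat \<Rightarrow> nat" where
  "row_below mu T x i = card {j. (i, j) \<in> young_diagram mu \<and> T (i, j) < x}"

lemma less_row_below_iff:
  assumes T: "T \<in> semistandard_tableaux mu"
  shows "j < row_below mu T x i \<longleftrightarrow> (i, j) \<in> young_diagram mu \<and> T (i, j) < x"
proof -
  let ?S = "{j. (i, j) \<in> young_diagram mu \<and> T (i, j) < x}"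
  have "?S = {..<card ?S}"
  proof (rule initial_segment_eq_lessThan_card)
    show "finite ?S"
      by (rule finite_subset[of _ "{..<mu ! i}"]) (auto simp: young_diagram_def)
    show "j \<in> ?S" if "j' \<in> ?S" "j \<le> j'" for j j'
      using that tableau_row_mono[OF T, of i j' j] young_diagram_left[of i j' mu j] by auto
  qed
  then show ?thesis by (auto simp: row_below_def)
qed

lemma row_below_mono:
  assumes T: "T \<in> semistandard_tableaux mu" and "x \<le> y"
  shows "row_below mu T x i \<le> row_below mu T y i"
proof -
  have "j < row_below mu T y i" if "j < row_below mu T x i" for j
    using that \<open>x \<le> y\<close> by (simp add: less_row_below_iff[OF T])
  then show ?thesis by (meson leI less_irrefl)
qed

lemma row_below_interlace:
  assumes T: "T \<in> semistandard_tableaux mu" and mu: "sorted_wrt (\<ge>) mu"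
  shows "row_below mu T (Suc x) (Suc i) \<le> row_below mu T x i"
proof -
  have "j < row_below mu T x i" if "j < row_below mu T (Suc x) (Suc i)" for j
  proof -
    have c: "(Suc i, j) \<in> young_diagram mu" "T (Suc i, j) < Suc x"
      using that by (simp_all add: less_row_below_iff[OF T])
    then have "(i, j) \<in> young_diagram mu"
      using young_diagram_up[OF mu] by (metis le_SucI order_refl)
    moreover have "T (i, j) < T (Suc i, j)"
      using T c by (auto simp: semistandard_tableaux_def)
    ultimately show ?thesis
      using c by (simp add: less_row_below_iff[OF T])
  qed
  then show ?thesis by (meson leI less_irrefl)
qed

lemma row_below_outside: "length mu \<le> i \<Longrightarrow> row_below mu T x i = 0"
  by (simp add: row_below_def young_diagram_def)

text \<open>
  If the shapes of the entries less than \<open>a\<close> and less than \<open>a + 2\<close> are held fixed, then the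
  interlacing conditions on the shape in between confine each of its rows, independently, to an
  interval.  The involution reflects every row length in its interval.
\<close>
definition lower_end :: "nat list \<Rightarrow> nat \<Rightarrow> (nat \<times> nat \<Rightarrow> nat) \<Rightarrow> nat \<Rightarrow> nat" where
  "lower_end mu a T i = max (row_below mu T a i) (row_below mu T (a + 2) (Suc i))"

definition upper_end :: "nat list \<Rightarrow> nat \<Rightarrow> (nat \<times> nat \<Rightarrow> nat) \<Rightarrow> nat \<Rightarrow> nat" where
  "upper_end mu a T i = (case i of 0 \<Rightarrow> row_below mu T (a + 2) i
    | Suc k \<Rightarrow> min (row_below mu T (a + 2) i) (row_below mu T a k))"

definition toggled_length :: "nat list \<Rightarrow> nat \<Rightarrow> (nat \<times> nat \<Rightarrow> nat) \<Rightarrow> nat \<Rightarrow> nat" where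
  "toggled_length mu a T i = lower_end mu a T i + upper_end mu a T i - row_below mu T (a + 1) i"

definition bender_knuth :: "nat list \<Rightarrow> nat \<Rightarrow> (nat \<times> nat \<Rightarrow> nat) \<Rightarrow> nat \<times> nat \<Rightarrow> nat" where
  "bender_knuth mu a T = restrict (\<lambda>(i, j).
    if T (i, j) \<in> {a, a + 1} then if j < toggled_length mu a T i then a else a + 1 else T (i, j))
    (young_diagram mu)"

lemma
  assumes T: "T \<in> semistandard_tableaux mu" and mu: "sorted_wrt (\<ge>) mu"
  shows toggled_length_plus: "toggled_length mu a T i + row_below mu T (a + 1) i =
      lower_end mu a T i + upper_end mu a T i"
    and lower_end_le: "lower_end mu a T i \<le> toggled_length mu a T i"
    and le_upper_end: "toggled_length mu a T i \<le> upper_end mu a T i"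
proof -
  have "row_below mu T (a + 1) i \<le> upper_end mu a T i"
    using row_below_mono[OF T, of "a + 1" "a + 2" i] row_below_interlace[OF T mu, of a "i - 1"]
    by (cases i) (auto simp: upper_end_def)
  moreover have "lower_end mu a T i \<le> row_below mu T (a + 1) i"
    using row_below_mono[OF T, of a "a + 1" i] row_below_interlace[OF T mu, of "a + 1" i]
    by (simp add: lower_end_def)
  ultimately show "toggled_length mu a T i + row_below mu T (a + 1) i =
      lower_end mu a T i + upper_end mu a T i"
    and "lower_end mu a T i \<le> toggled_length mu a T i"
    and "toggled_length mu a T i \<le> upper_end mu a T i"
    by (simp_all add: toggled_length_def)
qed

lemma toggled_length_le:
  assumes T: "T \<in> semistandard_tableaux mu" and mu: "sorted_wrt (\<ge>) mu"
  shows "row_below mu T a i \<le> toggled_length mu a T i"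
    and "row_below mu T (a + 2) (Suc i) \<le> toggled_length mu a T i"
    and "toggled_length mu a T i \<le> row_below mu T (a + 2) i"
    and "toggled_length mu a T (Suc i) \<le> row_below mu T a i"
  using lower_end_le[OF T mu, of a i] le_upper_end[OF T mu, of a i]
    le_upper_end[OF T mu, of a "Suc i"]
  by (auto simp: lower_end_def upper_end_def split: nat.splits)

text \<open>
  The involution changes only one shape of the chain, namely that of the entries less than
  \<open>a + 1\<close>.
\<close>
lemma bender_knuth_less_iff:
  assumes T: "T \<in> semistandard_tableaux mu" and mu: "sorted_wrt (\<ge>) mu"
    and c: "(i, j) \<in> young_diagram mu"
  shows "bender_knuth mu a T (i, j) < x \<longleftrightarrow>
    (if x = a + 1 then j < toggled_length mu a T i else T (i, j) < x)"
proof -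
  have "j < row_below mu T x i \<longleftrightarrow> T (i, j) < x" for x
    using c by (simp add: less_row_below_iff[OF T])
  from this[of a] this[of "a + 2"] show ?thesis
    using toggled_length_le(1,3)[OF T mu, of a i] c
    by (auto simp: bender_knuth_def)
qed

lemma bender_knuth_semistandard:
  assumes T: "T \<in> semistandard_tableaux mu" and mu: "sorted_wrt (\<ge>) mu"
  shows "bender_knuth mu a T \<in> semistandard_tableaux mu"
proof -
  let ?T = "bender_knuth mu a T"
  have row: "?T (i, j) \<le> ?T (i, Suc j)" if c: "(i, Suc j) \<in> young_diagram mu" for i j
  proof -
    have c': "(i, j) \<in> young_diagram mu"
      using c by (rule young_diagram_left) simp
    have "?T (i, Suc j) < x \<Longrightarrow> ?T (i, j) < x" for x
      using bender_knuth_less_iff[OF T mu c, of a x] bender_knuth_less_iff[OF T mu c', of a x]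
        tableau_row_mono[OF T c, of j] by (auto split: if_splits)
    then show ?thesis by (metis lessI not_less_eq not_le)
  qed
  have col: "?T (i, j) < ?T (Suc i, j)" if c: "(Suc i, j) \<in> young_diagram mu" for i j
  proof -
    have c': "(i, j) \<in> young_diagram mu"
      using mu c by (rule young_diagram_up) simp
    have lt: "T (i, j) < T (Suc i, j)"
      using T c by (auto simp: semistandard_tableaux_def)
    have "?T (i, j) < x" if "?T (Suc i, j) < Suc x" for x
    proof (cases "x = a \<or> x = a + 1")
      case False
      then show ?thesis
        using that lt by (simp add: bender_knuth_less_iff[OF T mu c] bender_knuth_less_iff[OF T mu c'])
    next
      case True
      then show ?thesis
      proof
        assume "x = a"
        then show ?thesis
          using that toggled_length_le(4)[OF T mu, of a i] less_row_below_iff[OF T, of j a i]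
          by (simp add: bender_knuth_less_iff[OF T mu c] bender_knuth_less_iff[OF T mu c'])
      next
        assume x: "x = a + 1"
        then have "T (Suc i, j) < a + 2"
          using that by (simp add: bender_knuth_less_iff[OF T mu c])
        then have "j < row_below mu T (a + 2) (Suc i)"
          using c by (simp add: less_row_below_iff[OF T])
        then have "j < toggled_length mu a T i"
          using toggled_length_le(2)[OF T mu, of a i] by simp
        then show ?thesis
          by (simp add: bender_knuth_less_iff[OF T mu c'] x)
      qed
    qed
    then show ?thesis by blast
  qed
  show ?thesis
    using row col unfolding semistandard_tableaux_def by (auto simp: bender_knuth_def)
qed

lemma row_below_bender_knuth:
  assumes T: "T \<in> semistandard_tableaux mu" and mu: "sorted_wrt (\<ge>) mu"
  shows "row_below mu (bender_knuth mu a T) x i =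
    (if x = a + 1 then toggled_length mu a T i else row_below mu T x i)"
proof -
  note T' = bender_knuth_semistandard[OF T mu, of a]
  have "j < toggled_length mu a T i \<Longrightarrow> (i, j) \<in> young_diagram mu" for j
    using toggled_length_le(3)[OF T mu, of a i] less_row_below_iff[OF T, of j "a + 2" i] by simp
  then have "j < row_below mu (bender_knuth mu a T) x i \<longleftrightarrow>
      j < (if x = a + 1 then toggled_length mu a T i else row_below mu T x i)" for j
    using bender_knuth_less_iff[OF T mu, of i j a x]
    by (auto simp: less_row_below_iff[OF T] less_row_below_iff[OF T'])
  then show ?thesis by (rule nat_eqI_below)
qed

text \<open>The ends of the intervals depend only on the outer shapes, and reflecting twice is the identity.\<close>
lemma bender_knuth_involution:
  assumes T: "T \<in> semistandard_tableaux mu" and mu: "sorted_wrt (\<ge>) mu"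
  shows "bender_knuth mu a (bender_knuth mu a T) = T"
proof
  fix c
  let ?T = "bender_knuth mu a T"
  note T' = bender_knuth_semistandard[OF T mu, of a]
  show "bender_knuth mu a ?T c = T c"
  proof (cases "c \<in> young_diagram mu")
    case False
    then show ?thesis using T by (cases c) (auto simp: bender_knuth_def semistandard_tableaux_def extensional_def)
  next
    case True
    obtain i j where c: "c = (i, j)" by (cases c)
    have "toggled_length mu a ?T i + toggled_length mu a T i = toggled_length mu a T i + row_below mu T (a + 1) i"
      using toggled_length_plus[OF T mu, of a i] toggled_length_plus[OF T' mu, of a i]
      by (simp add: row_below_bender_knuth[OF T mu] lower_end_def upper_end_def cong: nat.case_cong)
    then have len: "toggled_length mu a ?T i = row_below mu T (a + 1) i" by simp
    have "bender_knuth mu a ?T c < x \<longleftrightarrow> T c < x" for x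
      using True bender_knuth_less_iff[OF T' mu, of i j a x] bender_knuth_less_iff[OF T mu, of i j a x]
      by (auto simp: c len less_row_below_iff[OF T])
    then show ?thesis by (rule nat_eqI_above)
  qed
qed

definition tableau_content :: "nat list \<Rightarrow> (nat \<times> nat \<Rightarrow> nat) \<Rightarrow> nat multiset" where
  "tableau_content mu T = image_mset T (mset_set (young_diagram mu))"

lemma count_image_mset_set:
  assumes "finite A"
  shows "count (image_mset f (mset_set A)) x = card {a \<in> A. f a = x}"
proof -
  have "count (image_mset f (mset_set A)) x = (\<Sum>a\<in>f -` {x} \<inter> set_mset (mset_set A). count (mset_set A) a)"
    by (rule count_image_mset)
  also have "\<dots> = (\<Sum>a\<in>{a \<in> A. f a = x}. 1)"
    using assms by (intro sum.cong) auto
  finally show ?thesis by simp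
qed

lemma count_image_mset_inj: "inj f \<Longrightarrow> count (image_mset f M) (f x) = count M x"
  by (induction M) (auto dest: injD)

lemma count_tableau_content:
  "count (tableau_content mu T) x + (\<Sum>i<length mu. row_below mu T x i) =
    (\<Sum>i<length mu. row_below mu T (Suc x) i)"
proof -
  have "count (tableau_content mu T) x = card {c \<in> young_diagram mu. T c = x}"
    by (simp add: tableau_content_def count_image_mset_set)
  moreover have "card {c \<in> young_diagram mu. T c < x} + card {c \<in> young_diagram mu. T c = x} =
      card ({c \<in> young_diagram mu. T c < x} \<union> {c \<in> young_diagram mu. T c = x})"
    by (intro card_Un_disjoint[symmetric]) auto
  moreover have "{c \<in> young_diagram mu. T c < x} \<union> {c \<in> young_diagram mu. T c = x} =
      {c \<in> young_diagram mu. T c < Suc x}"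
    by auto
  ultimately show ?thesis
    by (simp add: row_below_def card_young_diagram_filter)
qed

text \<open>
  The minimum in the upper end of row \<open>i + 1\<close> involves the same two numbers as the maximum in the
  lower end of row \<open>i\<close>, and $\max + \min$ is the sum.  So the reflection sends the size of
  the middle shape to the sum of the sizes of its neighbours minus itself, which exchanges the
  multiplicities of \<open>a\<close> and \<open>a + 1\<close>.
\<close>
lemma sum_ends:
  "(\<Sum>i<L. lower_end mu a T i + upper_end mu a T i) + upper_end mu a T L =
    (\<Sum>i<L. row_below mu T a i + row_below mu T (a + 2) i) + row_below mu T (a + 2) L"
proof (induction L)
  case (Suc L)
  have "lower_end mu a T L + upper_end mu a T (Suc L) = row_below mu T a L + row_below mu T (a + 2) (Suc L)"
    by (simp add: lower_end_def upper_end_def max_def min_def)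
  with Suc show ?case by simp
qed (simp add: upper_end_def)

lemma sum_toggled_length:
  assumes T: "T \<in> semistandard_tableaux mu" and mu: "sorted_wrt (\<ge>) mu"
  shows "(\<Sum>i<length mu. toggled_length mu a T i) + (\<Sum>i<length mu. row_below mu T (a + 1) i) =
    (\<Sum>i<length mu. row_below mu T a i) + (\<Sum>i<length mu. row_below mu T (a + 2) i)"
proof -
  have "upper_end mu a T (length mu) = 0"
    by (auto simp: upper_end_def row_below_outside split: nat.split)
  then show ?thesis
    using sum_ends[of mu a T "length mu"]
    unfolding sum.distrib[symmetric] toggled_length_plus[OF T mu]
    by (simp add: row_below_outside)
qed

lemma content_bender_knuth:
  assumes T: "T \<in> semistandard_tableaux mu" and mu: "sorted_wrt (\<ge>) mu"
  shows "tableau_content mu (bender_knuth mu a T) =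
    image_mset (transpose a (Suc a)) (tableau_content mu T)"
proof (rule multiset_eqI)
  fix x
  define \<tau> where "\<tau> = transpose a (Suc a)"
  have "inj \<tau>" by (simp add: \<tau>_def)
  then have "count (image_mset \<tau> M) x = count M (\<tau> x)" for M
    using count_image_mset_inj[of \<tau> M "\<tau> x"] by (simp add: \<tau>_def)
  moreover have "count (tableau_content mu (bender_knuth mu a T)) x = count (tableau_content mu T) (\<tau> x)"
    using count_tableau_content[of mu "bender_knuth mu a T" x]
      count_tableau_content[of mu T x] count_tableau_content[of mu T a]
      count_tableau_content[of mu T "Suc a"] sum_toggled_length[OF T mu, of a]
    by (cases "x = a"; cases "x = Suc a")
      (simp_all add: row_below_bender_knuth[OF T mu] \<tau>_def transpose_def)
  ultimately show "count (tableau_content mu (bender_knuth mu a T)) x =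
      count (image_mset (transpose a (Suc a)) (tableau_content mu T)) x"
    by (simp flip: \<tau>_def)
qed

definition kostka :: "nat list \<Rightarrow> nat multiset \<Rightarrow> nat" where
  "kostka mu m = card {T \<in> semistandard_tableaux mu. tableau_content mu T = m}"

lemma mcoeff_schur: "mcoeff (schur mu) m = of_nat (kostka mu m)"
  by (simp add: schur_def kostka_def tableau_content_def)

lemma kostka_transpose:
  assumes mu: "sorted_wrt (\<ge>) mu"
  shows "kostka mu (image_mset (transpose a (Suc a)) m) = kostka mu m"
proof -
  let ?\<tau> = "transpose a (Suc a)"
  have twice: "image_mset ?\<tau> (image_mset ?\<tau> m) = m" for m
    by (simp add: multiset.map_comp)
  have "bij_betw (bender_knuth mu a) {T \<in> semistandard_tableaux mu. tableau_content mu T = m}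
      {T \<in> semistandard_tableaux mu. tableau_content mu T = image_mset ?\<tau> m}"
    by (rule bij_betw_byWitness[where f' = "bender_knuth mu a"])
      (auto simp: bender_knuth_involution bender_knuth_semistandard content_bender_knuth mu twice)
  then show ?thesis by (simp add: kostka_def bij_betw_same_card)
qed


section \<open>Kostka numbers and the Schur lattice\<close>

lemma tableau_entry_ge_row:
  assumes mu: "sorted_wrt (\<ge>) mu" and T: "T \<in> semistandard_tableaux mu"
  shows "(i, j) \<in> young_diagram mu \<Longrightarrow> i \<le> T (i, j)"
proof (induction i)
  case (Suc i)
  then have "(i, j) \<in> young_diagram mu"
    using young_diagram_up[OF mu] by (metis le_SucI order_refl)
  moreover have "T (i, j) < T (Suc i, j)"
    using Suc.prems T by (auto simp: semistandard_tableaux_def)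
  ultimately show ?case using Suc.IH by simp
qed simp

text \<open>
  The monomial $\prod_i x_i^{\mu_i}$, as the content of the tableau with all entries \<open>i\<close> in row
  \<open>i\<close>; the rank is the sum of the entries of this tableau.
\<close>
definition partition_content :: "nat list \<Rightarrow> nat multiset" where
  "partition_content mu = tableau_content mu fst"

definition partition_rank :: "nat list \<Rightarrow> nat" where
  "partition_rank mu = (\<Sum>c\<in>young_diagram mu. fst c)"

lemma sum_mset_tableau_content: "sum_mset (tableau_content mu T) = (\<Sum>c\<in>young_diagram mu. T c)"
  by (simp add: tableau_content_def sum_unfold_sum_mset)

lemma superstandard_tableau:
  assumes mu: "sorted_wrt (\<ge>) mu"
  shows "restrict fst (young_diagram mu) \<in> semistandard_tableaux mu"
    and "tableau_content mu (restrict fst (young_diagram mu)) = partition_content mu"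
proof -
  show "restrict fst (young_diagram mu) \<in> semistandard_tableaux mu"
    unfolding semistandard_tableaux_def
  proof (intro CollectI conjI allI impI)
    fix i j assume c: "(i, Suc j) \<in> young_diagram mu"
    then have "(i, j) \<in> young_diagram mu"
      by (rule young_diagram_left) simp
    with c show "restrict fst (young_diagram mu) (i, j) \<le> restrict fst (young_diagram mu) (i, Suc j)"
      by simp
  next
    fix i j assume c: "(Suc i, j) \<in> young_diagram mu"
    with mu have "(i, j) \<in> young_diagram mu"
      by (rule young_diagram_up) simp
    with c show "restrict fst (young_diagram mu) (i, j) < restrict fst (young_diagram mu) (Suc i, j)"
      by simp
  qed simp
  show "tableau_content mu (restrict fst (young_diagram mu)) = partition_content mu"
    unfolding partition_content_def tableau_content_def by (rule image_mset_cong) simp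
qed

text \<open>
  The content determines the sum of the entries, and each entry is at least its row index.
\<close>
lemma tableau_with_partition_content:
  assumes lam: "sorted_wrt (\<ge>) lam"
    and T: "T \<in> semistandard_tableaux lam" and content: "tableau_content lam T = partition_content mu"
  shows "partition_rank lam \<le> partition_rank mu"
    and "partition_rank lam = partition_rank mu \<Longrightarrow> T = restrict fst (young_diagram lam)"
proof -
  have ge: "fst c \<le> T c" if "c \<in> young_diagram lam" for c
    using tableau_entry_ge_row[OF lam T, of "fst c" "snd c"] that by simp
  have sum: "(\<Sum>c\<in>young_diagram lam. T c) = partition_rank mu"
    using arg_cong[OF content, of sum_mset]
    by (simp add: partition_content_def sum_mset_tableau_content partition_rank_def)
  then show "partition_rank lam \<le> partition_rank mu"
    unfolding partition_rank_def[of lam] sum[symmetric] using ge by (intro sum_mono)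
  assume eq: "partition_rank lam = partition_rank mu"
  have "T c = fst c" if "c \<in> young_diagram lam" for c
  proof (rule ccontr)
    assume "T c \<noteq> fst c"
    then have "fst c < T c" using ge[OF that] by simp
    then have "(\<Sum>c\<in>young_diagram lam. fst c) < (\<Sum>c\<in>young_diagram lam. T c)"
      using that ge by (intro sum_strict_mono_ex1) auto
    then show False
      using eq sum by (simp add: partition_rank_def)
  qed
  then show "T = restrict fst (young_diagram lam)"
    using T by (intro extensionalityI[of _ "young_diagram lam"]) (auto simp: semistandard_tableaux_def)
qed

lemma count_partition_content: "count (partition_content mu) i = (if i < length mu then mu ! i else 0)"
proof -
  have "count (partition_content mu) i = card {c \<in> young_diagram mu. fst c = i}"
    by (simp add: partition_content_def tableau_content_def count_image_mset_set)
  also have "{c \<in> young_diagram mu. fst c = i} = (if i < length mu then Pair i ` {..<mu ! i} else {})"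
    by (auto simp: young_diagram_def)
  finally show ?thesis by (simp add: card_image inj_on_def)
qed

lemma inj_on_partition_content:
  assumes "0 \<notin> set lam" "0 \<notin> set mu" and eq: "partition_content lam = partition_content mu"
  shows "lam = mu"
proof (rule nth_equalityI)
  have counts: "(if i < length lam then lam ! i else 0) = (if i < length mu then mu ! i else 0)" for i
    using eq count_partition_content by metis
  have pos: "0 < nu ! i" if "0 \<notin> set nu" "i < length nu" for nu :: "nat list" and i
    using that by (metis gr0I nth_mem)
  have "i < length lam \<longleftrightarrow> i < length mu" for i
    using counts[of i] pos[OF assms(1), of i] pos[OF assms(2), of i] by (auto split: if_splits)
  then show len: "length lam = length mu"
    by (rule nat_eqI_below)
  show "lam ! i = mu ! i" if "i < length lam" for i
    using counts[of i] that len by simp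
qed

lemma kostka_diagonal:
  assumes "sorted_wrt (\<ge>) mu"
  shows "kostka mu (partition_content mu) = 1"
proof -
  have "{T \<in> semistandard_tableaux mu. tableau_content mu T = partition_content mu} =
      {restrict fst (young_diagram mu)}"
    using tableau_with_partition_content(2)[OF assms] superstandard_tableau[OF assms] by blast
  then show ?thesis by (simp add: kostka_def)
qed

lemma kostka_triangular:
  assumes lam: "lam \<in> partitions n" and mu: "mu \<in> partitions n" and "lam \<noteq> mu"
    and rank: "\<not> partition_rank lam < partition_rank mu"
  shows "kostka lam (partition_content mu) = 0"
proof -
  have "False" if T: "T \<in> semistandard_tableaux lam" "tableau_content lam T = partition_content mu" for T
  proof -
    have sorted: "sorted_wrt (\<ge>) lam" using lam by (simp add: partitions_def)
    then have "T = restrict fst (young_diagram lam)"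
      using tableau_with_partition_content[OF _ T] rank by simp
    then have "partition_content lam = partition_content mu"
      using T superstandard_tableau[OF sorted] by simp
    then show False
      using inj_on_partition_content[of lam mu] lam mu \<open>lam \<noteq> mu\<close> by (simp add: partitions_def)
  qed
  then have "{T \<in> semistandard_tableaux lam. tableau_content lam T = partition_content mu} = {}"
    by blast
  then show ?thesis by (simp only: kostka_def card.empty)
qed

lemma card_young_diagram: "card (young_diagram mu) = sum_list mu"
proof -
  have "card (young_diagram mu) = (\<Sum>i<length mu. card {j. (i, j) \<in> young_diagram mu})"
    using card_young_diagram_filter[of mu "\<lambda>_. True"] by simp
  also have "\<dots> = (\<Sum>i<length mu. mu ! i)"
    by (intro sum.cong refl) (simp add: young_diagram_def)
  finally show ?thesis by (simp add: sum_list_sum_nth atLeast0LessThan)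
qed

lemma size_tableau_content: "size (tableau_content mu T) = sum_list mu"
  by (simp add: tableau_content_def card_young_diagram)

lemma kostka_wrong_size: "size m \<noteq> sum_list mu \<Longrightarrow> kostka mu m = 0"
  using size_tableau_content[of mu] unfolding kostka_def by (subst card_eq_0_iff) blast

lemma finite_partitions: "finite (partitions n)"
proof (rule finite_subset)
  have len: "length mu \<le> sum_list mu" if "0 \<notin> set mu" for mu :: "nat list"
    using that by (induction mu) auto
  show "partitions n \<subseteq> {mu. set mu \<subseteq> {..n} \<and> length mu \<le> n}"
    using len member_le_sum_list by (fastforce simp: partitions_def)
qed (rule finite_lists_length_le, simp)

lemma partition_of_decreasing_counts:
  assumes dec: "\<And>i. count m (Suc i) \<le> count m i"
  obtains mu where "mu \<in> partitions (size m)" "partition_content mu = m"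
proof -
  define L where "L = (LEAST i. count m i = 0)"
  have "\<exists>i. i \<notin> set_mset m"
    using ex_new_if_finite[OF infinite_UNIV_nat finite_set_mset] .
  then have "\<exists>i. count m i = 0"
    by (simp add: not_in_iff)
  then have L: "count m L = 0"
    unfolding L_def by (rule LeastI_ex)
  have anti: "count m j \<le> count m i" if "i \<le> j" for i j
    using lift_Suc_antimono_le[of "count m"] dec that by blast
  have pos: "count m i \<noteq> 0" if "i < L" for i
    using not_less_Least[of i "\<lambda>i. count m i = 0"] that by (simp add: L_def)
  define mu where "mu = map (count m) [0..<L]"
  have content: "partition_content mu = m"
  proof (rule multiset_eqI)
    fix i
    have "count m i = 0" if "\<not> i < L"
      using anti[of L i] L that by simp
    then show "count (partition_content mu) i = count m i"
      by (simp add: count_partition_content mu_def)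
  qed
  moreover have "mu \<in> partitions (size m)"
  proof -
    have "sum_list mu = size m"
      using size_tableau_content[of mu fst] content by (simp add: partition_content_def)
    moreover have "0 \<notin> set mu"
    proof
      assume "0 \<in> set mu"
      then obtain i where "i < L" "count m i = 0"
        by (auto simp: mu_def)
      with pos show False by blast
    qed
    moreover have "sorted_wrt (\<ge>) mu"
      using anti by (auto simp: mu_def sorted_wrt_iff_nth_less)
    ultimately show ?thesis by (simp add: partitions_def)
  qed
  ultimately show ?thesis using that by blast
qed

lemma sum_mset_transpose_less:
  assumes "count m i < count m (Suc i)"
  shows "sum_mset (image_mset (transpose i (Suc i)) m) < sum_mset m"
proof -
  define r where "r = filter_mset (\<lambda>x. x \<noteq> i \<and> x \<noteq> Suc i) m"
  have m: "m = r + replicate_mset (count m i) i + replicate_mset (count m (Suc i)) (Suc i)"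
    by (rule multiset_eqI) (auto simp: r_def)
  have "image_mset (transpose i (Suc i)) r = image_mset (\<lambda>x. x) r"
    by (rule image_mset_cong) (auto simp: r_def transpose_def)
  then show ?thesis
    using assms by (subst (1 2) m) simp
qed

text \<open>Transpositions of adjacent variables suffice here, since they sort exponent vectors.\<close>
definition symmetric_mfps :: "'a mfps \<Rightarrow> bool" where
  "symmetric_mfps F \<longleftrightarrow> (\<forall>i m. mcoeff F (image_mset (transpose i (Suc i)) m) = mcoeff F m)"

text \<open>
  Swapping two adjacent variables whose exponents increase lowers the sum of the indices; monomials
  that admit no such swap are partition monomials.
\<close>
lemma symmetric_mfps_eq_0I:
  fixes F :: "'a::ab_group_add mfps"
  assumes sym: "symmetric_mfps F" and hom: "\<And>m. size m \<noteq> n \<Longrightarrow> mcoeff F m = 0"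
    and zero: "\<And>mu. mu \<in> partitions n \<Longrightarrow> mcoeff F (partition_content mu) = 0"
  shows "F = 0"
proof (rule mfps_eqI)
  fix m
  have "mcoeff F m = 0"
  proof (induction "sum_mset m" arbitrary: m rule: less_induct)
    case less
    consider "size m \<noteq> n" | i where "count m i < count m (Suc i)"
      | "size m = n" "\<And>i. count m (Suc i) \<le> count m i"
      by (meson not_le)
    then show ?case
    proof cases
      case 2
      then have "mcoeff F (image_mset (transpose i (Suc i)) m) = 0"
        by (intro less sum_mset_transpose_less)
      then show ?thesis
        using sym by (simp add: symmetric_mfps_def)
    next
      case 3
      from partition_of_decreasing_counts[OF 3(2)] obtain mu
        where "mu \<in> partitions (size m)" "partition_content mu = m" by blast
      with zero 3(1) show ?thesis by blast
    qed (rule hom)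
  qed
  then show "mcoeff F m = mcoeff 0 m" by simp
qed

text \<open>
  Unitriangularity yields an integral combination of Schur functions with the same coefficients as
  \<open>F\<close> at the partition monomials; a symmetric function is determined by these.
\<close>
lemma schur_lattice_memberI:
  fixes F :: "complex mfps"
  assumes sym: "symmetric_mfps F" and hom: "\<And>m. size m \<noteq> n \<Longrightarrow> mcoeff F m = 0"
    and int: "\<And>m. mcoeff F m \<in> \<int>"
  shows "F \<in> int_lattice n"
proof -
  define a where "a mu = (THE k :: int. mcoeff F (partition_content mu) = of_int k)" for mu
  have a: "mcoeff F (partition_content mu) = of_int (a mu)" for mu
    using int[of "partition_content mu"] by (auto simp: a_def Ints_def)
  let ?K = "\<lambda>lam mu. int (kostka lam (partition_content mu))"
  have diag: "?K mu mu = 1" if "mu \<in> partitions n" for mu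
    using that kostka_diagonal[of mu] by (simp add: partitions_def)
  have tri: "?K lam mu = 0" if "lam \<in> partitions n" "mu \<in> partitions n" "lam \<noteq> mu"
    "\<not> partition_rank lam < partition_rank mu" for lam mu
    using kostka_triangular[OF that] by simp
  obtain c :: "nat list \<Rightarrow> int" where c: "\<And>mu. mu \<in> partitions n \<Longrightarrow>
      (\<Sum>lam\<in>partitions n. c lam * ?K lam mu) = a mu"
    using unitriangular_solvable[of "partitions n" ?K partition_rank a, OF finite_partitions diag tri]
    by blast
  define G :: "complex mfps" where "G = (\<Sum>lam\<in>partitions n. of_int (c lam) *\<^sub>R schur lam)"
  have G: "mcoeff G m = (\<Sum>lam\<in>partitions n. of_int (c lam) * of_nat (kostka lam m))" for m
    by (simp add: G_def mcoeff_schur scaleR_conv_of_real)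
  have "F - G = 0"
  proof (rule symmetric_mfps_eq_0I[where n = n])
    have "mcoeff G (image_mset (transpose i (Suc i)) m) = mcoeff G m" for i m
      unfolding G by (intro sum.cong) (auto simp: kostka_transpose partitions_def)
    then show "symmetric_mfps (F - G)"
      using sym by (simp add: symmetric_mfps_def)
    show "mcoeff (F - G) m = 0" if "size m \<noteq> n" for m
    proof -
      have "mcoeff G m = 0"
        unfolding G using that by (intro sum.neutral) (auto simp: kostka_wrong_size partitions_def)
      then show ?thesis using hom[OF that] by simp
    qed
    show "mcoeff (F - G) (partition_content mu) = 0" if "mu \<in> partitions n" for mu
    proof -
      have "mcoeff G (partition_content mu) = of_int (\<Sum>lam\<in>partitions n. c lam * ?K lam mu)"
        by (simp add: G)
      then show ?thesis by (simp add: a c[OF that])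
    qed
  qed
  then have "F = G" by simp
  then show ?thesis
    unfolding int_lattice_def int_span_def G_def by blast
qed

lemma schur_coeffs_integer:
  fixes F :: "complex mfps" and c :: "nat list \<Rightarrow> real"
  assumes F: "F = (\<Sum>lam\<in>partitions n. c lam *\<^sub>R schur lam)" and int: "\<And>m. mcoeff F m \<in> \<int>"
    and mu: "mu \<in> partitions n"
  shows "c mu \<in> \<int>"
proof (rule unitriangular_coeffs_in_subgroup[of "partitions n"
      "\<lambda>lam mu. int (kostka lam (partition_content mu))" partition_rank])
  show "int (kostka mu (partition_content mu)) = 1" if "mu \<in> partitions n" for mu
    using that kostka_diagonal[of mu] by (simp add: partitions_def)
  show "(\<Sum>lam\<in>partitions n. c lam * of_int (int (kostka lam (partition_content mu)))) \<in> \<int>" for mu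
  proof -
    have "mcoeff F (partition_content mu) =
        of_real (\<Sum>lam\<in>partitions n. c lam * of_int (int (kostka lam (partition_content mu))))"
      by (simp add: F mcoeff_schur scaleR_conv_of_real)
    with int[of "partition_content mu"] show ?thesis
      by (metis Ints_cases Ints_of_int of_real_eq_iff of_real_of_int_eq)
  qed
qed (use mu in \<open>simp_all add: finite_partitions kostka_triangular\<close>)

lemma mcoeff_int_lattice_integer:
  assumes "F \<in> int_lattice n"
  shows "mcoeff F m \<in> \<int>"
  using assms
  by (auto simp: int_lattice_def int_span_def mcoeff_schur scaleR_conv_of_real
      intro!: Ints_sum Ints_mult)


section \<open>The real span and its lattice points\<close>

lemma int_combination_Qfun_in_int_lattice:
  assumes n: "n \<ge> 1"
  shows "(\<Sum>d | d dvd n. of_int (k d) *\<^sub>R Qfun n d) \<in> int_lattice n"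
proof (rule schur_lattice_memberI)
  show "symmetric_mfps (\<Sum>d | d dvd n. of_int (k d) *\<^sub>R Qfun n d)"
    using n by (auto simp: symmetric_mfps_def mcoeff_Qfun necklaces_image_mset intro!: sum.cong)
qed (use n in \<open>auto simp: mcoeff_Qfun scaleR_conv_of_real intro!: Ints_mult\<close>)

text \<open>The matrix of the coefficients of the $Q_{n,d}$ at the test monomials is unitriangular.\<close>
lemma Qfun_coeffs_in_subgroup:
  fixes x :: "nat \<Rightarrow> real"
  assumes n: "n \<ge> 1" and F: "F = (\<Sum>d | d dvd n. x d *\<^sub>R Qfun n d)"
    and S0: "0 \<in> S" and S: "\<And>a b k. a \<in> S \<Longrightarrow> b \<in> S \<Longrightarrow> a - b * of_int k \<in> S"
    and coeffs: "\<And>m. mcoeff F m \<in> of_real ` S"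
    and d: "d dvd n"
  shows "x d \<in> S"
proof (rule unitriangular_coeffs_in_subgroup[of "{d. d dvd n}"
      "\<lambda>d e. int (necklaces (n div d) (test_monomial n e))" "\<lambda>d. d" S x])
  fix d e assume de: "d \<in> {d. d dvd n}" "e \<in> {d. d dvd n}" "d \<noteq> e" "\<not> d < e"
  moreover have "0 < e"
    using de n by (auto intro: Nat.gr0I)
  ultimately have "\<not> d dvd e"
    by (auto dest!: dvd_imp_le)
  then show "int (necklaces (n div d) (test_monomial n e)) = 0"
    using de n by (simp add: necklaces_test_monomial_eq_0)
next
  fix e assume e: "e \<in> {d. d dvd n}"
  have "mcoeff F (test_monomial n e) =
      of_real (\<Sum>d | d dvd n. x d * of_int (int (necklaces (n div d) (test_monomial n e))))"
    using n e by (simp add: F mcoeff_Qfun size_test_monomial scaleR_conv_of_real)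
  then show "(\<Sum>d | d dvd n. x d * of_int (int (necklaces (n div d) (test_monomial n e)))) \<in> S"
    using coeffs[of "test_monomial n e"] by (auto simp only: of_real_eq_iff image_iff)
qed (use n d S0 S in \<open>simp_all add: necklaces_test_monomial_diagonal\<close>)

lemma Qfun_coeffs_integer:
  fixes x :: "nat \<Rightarrow> real"
  assumes "n \<ge> 1" and "\<And>m. mcoeff (\<Sum>d | d dvd n. x d *\<^sub>R Qfun n d) m \<in> \<int>" and "d dvd n"
  shows "x d \<in> \<int>"
proof (rule Qfun_coeffs_in_subgroup[OF assms(1) refl])
  show "mcoeff (\<Sum>d | d dvd n. x d *\<^sub>R Qfun n d) m \<in> of_real ` \<int>" for m
  proof -
    obtain k where "mcoeff (\<Sum>d | d dvd n. x d *\<^sub>R Qfun n d) m = of_int k"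
      using assms(2) by (rule Ints_cases)
    then have "mcoeff (\<Sum>d | d dvd n. x d *\<^sub>R Qfun n d) m = of_real (of_int k)"
      by simp
    then show ?thesis by (rule image_eqI) simp
  qed
qed (use assms(3) in simp_all)

lemma Qfun_independent:
  fixes x :: "nat \<Rightarrow> real"
  assumes "n \<ge> 1" and "(\<Sum>d | d dvd n. x d *\<^sub>R Qfun n d) = 0" and "d dvd n"
  shows "x d = 0"
  using Qfun_coeffs_in_subgroup[OF assms(1) refl, of "{0}" x d] assms(2,3) by simp

text \<open>
  The expansion of $p_d^{n/d}$ in the $Q_{n,e}$ contains $Q_{n,d}$ with a nonzero coefficient and
  otherwise only proper multiples \<open>e\<close> of \<open>d\<close>.
\<close>
lemma Qfun_in_R_space:
  assumes n: "n \<ge> 1"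
  shows "d dvd n \<Longrightarrow> Qfun n d \<in> R_space n"
proof (induction "n - d" arbitrary: d rule: less_induct)
  case less
  let ?A = "{e. e dvd n \<and> d dvd e}"
  have fin: "finite ?A" and d: "d \<in> ?A"
    using n less.prems by simp_all
  have rest: "Qfun n e \<in> R_space n" if "e \<in> ?A - {d}" for e
  proof (rule less.hyps)
    show "e dvd n" using that by simp
    have "0 < e" "0 < n" using that n by (auto intro: Nat.gr0I)
    then have "d \<le> e" "e \<le> n"
      using that by (auto intro: dvd_imp_le)
    then show "n - e < n - d"
      using that by auto
  qed
  have "psum d ^ (n div d) = real (n div d) *\<^sub>R Qfun n d + (\<Sum>e\<in>?A - {d}. real (n div e) *\<^sub>R Qfun n e)"
    unfolding psum_power_eq_sum_Qfun[OF n less.prems] using fin d by (rule sum.remove)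
  then have "Qfun n d = inverse (real (n div d)) *\<^sub>R
      (psum d ^ (n div d) - (\<Sum>e\<in>?A - {d}. real (n div e) *\<^sub>R Qfun n e))"
    using n less.prems by (auto simp: dvd_div_eq_0_iff)
  also have "\<dots> \<in> R_space n"
    using rest less.prems unfolding R_space_def
    by (intro span_scale span_diff span_sum) (auto intro: span_base)
  finally show ?case .
qed

lemma R_space_eq:
  assumes n: "n \<ge> 1"
  shows "R_space n = {\<Sum>d | d dvd n. x d *\<^sub>R Qfun n d | x. True}" (is "_ = ?V")
proof
  have "subspace ?V"
  proof (rule subspaceI)
    show "0 \<in> ?V"
      by (auto intro!: exI[of _ "\<lambda>_. 0"])
  next
    fix F G assume "F \<in> ?V" "G \<in> ?V"
    then obtain x y where "F = (\<Sum>d | d dvd n. x d *\<^sub>R Qfun n d)" "G = (\<Sum>d | d dvd n. y d *\<^sub>R Qfun n d)"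
      by blast
    then have "F + G = (\<Sum>d | d dvd n. (x d + y d) *\<^sub>R Qfun n d)"
      by (simp add: scaleR_add_left sum.distrib)
    then show "F + G \<in> ?V" by (intro CollectI exI[of _ "\<lambda>d. x d + y d"]) simp
  next
    fix a F assume "F \<in> ?V"
    then obtain x where "F = (\<Sum>d | d dvd n. x d *\<^sub>R Qfun n d)"
      by blast
    then have "a *\<^sub>R F = (\<Sum>d | d dvd n. (a * x d) *\<^sub>R Qfun n d)"
      by (simp add: scaleR_sum_right)
    then show "a *\<^sub>R F \<in> ?V" by (intro CollectI exI[of _ "\<lambda>d. a * x d"]) simp
  qed
  moreover have "psum d ^ (n div d) \<in> ?V" if d: "d dvd n" for d
  proof -
    have "(\<Sum>e | e dvd n \<and> d dvd e. real (n div e) *\<^sub>R Qfun n e) =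
        (\<Sum>e | e dvd n. (if d dvd e then real (n div e) else 0) *\<^sub>R Qfun n e)"
      using n by (intro sum.mono_neutral_cong_left) auto
    then show ?thesis
      unfolding psum_power_eq_sum_Qfun[OF n d] by (intro CollectI exI) simp
  qed
  ultimately show "R_space n \<subseteq> ?V"
    unfolding R_space_def by (intro span_minimal) auto
  show "?V \<subseteq> R_space n"
    using Qfun_in_R_space[OF n] subspace_span
    by (auto simp: R_space_def intro!: span_sum span_scale)
qed

theorem theorem2p14:
  fixes n :: nat
  assumes "n \<ge> 1"
  shows "is_int_direct_sum (R_space n \<inter> int_lattice n) {d. d dvd n} (Qfun n) \<and>
    is_int_direct_sum (R_space n \<inter> int_lattice n) {e. e dvd n} (\<lambda>e. foulkes n (int e)) \<and>
    (\<forall>(x :: nat \<Rightarrow> real) F. F = (\<Sum>d | d dvd n. x d *\<^sub>R Qfun n d) \<longrightarrow>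
      F \<in> R_space n \<and>
      (integer_coeffs (partitions n) schur F \<longleftrightarrow> (\<forall>d. d dvd n \<longrightarrow> x d \<in> \<int>)) \<and>
      ((\<forall>d. d dvd n \<longrightarrow> x d \<in> \<int>) \<longleftrightarrow>
        integer_coeffs {e. e dvd n} (\<lambda>e. foulkes n (int e)) F))"
proof -
  let ?D = "{d. d dvd n}" and ?K = "\<lambda>e d. of_bool (d dvd e) :: int"
  let ?Q = "Qfun n" and ?l = "\<lambda>e. foulkes n (int e)"
  have finD: "finite ?D" using assms by simp
  have diag: "?K e e = 1" if "e \<in> ?D" for e by simp
  \<comment> \<open>Proper divisors come later in the order, so the rank of \<open>e\<close> is \<open>n - e\<close>.\<close>
  have tri: "?K e d = 0" if "e \<in> ?D" "d \<in> ?D" "e \<noteq> d" "\<not> n - e < n - d" for e d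
  proof -
    have pos: "0 < e" "0 < n" using that assms by (auto intro: Nat.gr0I)
    then have "e \<le> n" "d dvd e \<Longrightarrow> d \<le> e"
      using that by (auto intro: dvd_imp_le)
    then show ?thesis using that by auto
  qed
  have l: "?l e = (\<Sum>d\<in>?D. of_int (?K e d) *\<^sub>R ?Q d)" if "e \<in> ?D" for e
  proof -
    have "(\<Sum>d | d dvd e. ?Q d) = (\<Sum>d\<in>?D. of_int (?K e d) *\<^sub>R ?Q d)"
      using that finD by (intro sum.mono_neutral_cong_left) (auto intro: dvd_trans)
    then show ?thesis
      using that assms by (simp add: foulkes_eq_sum_Qfun)
  qed
  have indep: "\<forall>d\<in>?D. x d = 0" if "(\<Sum>d\<in>?D. x d *\<^sub>R ?Q d) = 0" for x
    using Qfun_independent[OF assms that] by simp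
  note unitri = finD diag tri l indep
  note lattice = int_combination_Qfun_in_int_lattice[OF assms]
  have M: "R_space n \<inter> int_lattice n = int_span ?D ?Q"
  proof
    show "R_space n \<inter> int_lattice n \<subseteq> int_span ?D ?Q"
    proof
      fix F assume F: "F \<in> R_space n \<inter> int_lattice n"
      then obtain x :: "nat \<Rightarrow> real" where x: "F = (\<Sum>d\<in>?D. x d *\<^sub>R ?Q d)"
        using R_space_eq[OF assms] by auto
      have "x d \<in> \<int>" if "d \<in> ?D" for d
        using F mcoeff_int_lattice_integer[of F n] that
        by (intro Qfun_coeffs_integer[OF assms]) (simp_all only: x mem_Collect_eq Int_iff)
      then have "F = (\<Sum>d\<in>?D. of_int \<lfloor>x d\<rfloor> *\<^sub>R ?Q d)"
        unfolding x by (intro sum.cong) (auto elim: Ints_cases)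
      then show "F \<in> int_span ?D ?Q"
        unfolding int_span_def by (intro CollectI exI conjI TrueI)
    qed
    show "int_span ?D ?Q \<subseteq> R_space n \<inter> int_lattice n"
      using lattice R_space_eq[OF assms] by (auto simp: int_span_def)
  qed
  have "is_int_direct_sum (R_space n \<inter> int_lattice n) ?D ?Q"
    unfolding is_int_direct_sum_def
  proof (intro conjI allI impI ballI)
    fix c :: "nat \<Rightarrow> int" and d
    assume "(\<Sum>d\<in>?D. of_int (c d) *\<^sub>R ?Q d) = 0" and d: "d \<in> ?D"
    from indep[OF this(1)] d show "c d = 0" by simp
  qed (rule M)
  moreover have "is_int_direct_sum (R_space n \<inter> int_lattice n) ?D ?l"
    unfolding is_int_direct_sum_def
  proof (intro conjI allI impI ballI)
    show "R_space n \<inter> int_lattice n = int_span ?D ?l"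
      using int_span_unitriangular[of ?D ?K "\<lambda>e. n - e" ?l ?Q, OF unitri] M by simp
    fix c :: "nat \<Rightarrow> int" and e
    assume "(\<Sum>e\<in>?D. of_int (c e) *\<^sub>R ?l e) = 0" "e \<in> ?D"
    from independent_unitriangular[of ?D ?K "\<lambda>e. n - e" ?l ?Q, OF unitri this] show "c e = 0"
      by simp
  qed
  moreover have "F \<in> R_space n \<and>
      (integer_coeffs (partitions n) schur F \<longleftrightarrow> (\<forall>d. d dvd n \<longrightarrow> x d \<in> \<int>)) \<and>
      ((\<forall>d. d dvd n \<longrightarrow> x d \<in> \<int>) \<longleftrightarrow> integer_coeffs ?D ?l F)"
    if F: "F = (\<Sum>d\<in>?D. x d *\<^sub>R ?Q d)" for x :: "nat \<Rightarrow> real" and F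
  proof (intro conjI)
    show "F \<in> R_space n"
      using R_space_eq[OF assms] F by auto
    show "(\<forall>d. d dvd n \<longrightarrow> x d \<in> \<int>) \<longleftrightarrow> integer_coeffs ?D ?l F"
      unfolding F using integer_coeffs_unitriangular[of ?D ?K "\<lambda>e. n - e" ?l ?Q, OF unitri] by simp
    show "integer_coeffs (partitions n) schur F \<longleftrightarrow> (\<forall>d. d dvd n \<longrightarrow> x d \<in> \<int>)"
    proof
      assume "integer_coeffs (partitions n) schur F"
      then obtain c where "F = (\<Sum>lam\<in>partitions n. c lam *\<^sub>R schur lam)" "\<forall>lam\<in>partitions n. c lam \<in> \<int>"
        unfolding integer_coeffs_def by blast
      then have "mcoeff F m \<in> \<int>" for m
        by (auto simp: mcoeff_schur scaleR_conv_of_real elim!: Ints_cases intro!: Ints_sum Ints_mult)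
      then show "\<forall>d. d dvd n \<longrightarrow> x d \<in> \<int>"
        using Qfun_coeffs_integer[OF assms] F by blast
    next
      assume int: "\<forall>d. d dvd n \<longrightarrow> x d \<in> \<int>"
      then have "F = (\<Sum>d\<in>?D. of_int \<lfloor>x d\<rfloor> *\<^sub>R ?Q d)"
        unfolding F by (intro sum.cong) (auto elim: Ints_cases)
      then have "F \<in> int_lattice n"
        using lattice by simp
      then have "\<exists>c :: nat list \<Rightarrow> real. F = (\<Sum>lam\<in>partitions n. c lam *\<^sub>R schur lam)"
        by (auto simp: int_lattice_def int_span_def)
      moreover have "c lam \<in> \<int>" if "F = (\<Sum>lam\<in>partitions n. c lam *\<^sub>R schur lam)" "lam \<in> partitions n" for c lam
        using that(1) mcoeff_int_lattice_integer[OF \<open>F \<in> int_lattice n\<close>] that(2)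
        by (rule schur_coeffs_integer)
      ultimately show "integer_coeffs (partitions n) schur F"
        unfolding integer_coeffs_def by blast
    qed
  qed
  ultimately show ?thesis by blast
qed

end
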